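(* Let $R$ be a principal ideal domain, $p\in R$ a prime, and $C_\ast: C_0\xleftarrow{\partial_1}C_1\leftarrow\cdots\xleftarrow{\partial_N}C_N$ a chain complex of free $R$-modules of finite rank. Let $C_\ast^{[0]}=C_\ast$ (with matrices viewed over the localization $R_{(p)}$), and let $C_\ast^{[1]},C_\ast^{[2]},\ldots$, the exponents $a_1,a_2,\ldots$ and the numbers $m_{k,i}$ be obtained by the procedure described in the context. Then the sequence of complexes terminates at some $C_\ast^{[t]}$ in which all matrices are zero, and the $p$-torsion of $H_k(C_\ast;R)$ is isomorphic to $$\bigoplus_{1\leq i<t}\bigl(R/Rp^{a_1+\cdots+a_i}\bigr)^{m_{k+1,i}}.$$
   Context: The localization $R_{(p)}=\{\frac{a}{b}\in Q(R):\ b\notin Rp\}$ is a subring of the fraction field $Q(R)$; its non-units are exactly the multiples of $p$. Graph and Morse matchings. For a chain complex $D_\ast$ of free $R_{(p)}$-modules of finite rank with bases $I_k$ and boundary matrices $\partial_k$, let $\Gamma_{D_\ast}$ be the digraph with vertex set $\bigsqcup_k I_k$ and, for each nonzero entry $\partial_{k,u,v}=w$ (row $u\in I_{k-1}$, column $v\in I_k$), a directed edge from $v$ to $u$ of weight $w$, written $u\xleftarrow{w}v$. A set $\mathcal{M}$ of edges is a Morse matching if distinct edges in $\mathcal{M}$ share no vertex, all weights of edges in $\mathcal{M}$ are units, and the digraph $\Gamma^{\mathcal{M}}_{D_\ast}$, obtained by replacing each $u\xleftarrow{w}v$ in $\mathcal{M}$ by an edge $u\to v$ of weight $-1/w$,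 has no directed cycles. Let $\mathcal{M}_k$ be the set of edges of $\mathcal{M}$ coming from $\partial_k$. Reduction. The reduced complex $D'_\ast$ has $D'_k$ free on $I'_k$, the set of vertices in $I_k$ not incident to any edge of $\mathcal{M}$. Its boundary matrix has as entry in row $u'\in I'_{k-1}$ and column $v'\in I'_k$ the sum, over all directed paths from $v'$ to $u'$ in $\Gamma^{\mathcal{M}}_{D_\ast}$, of the products of edge weights. It is known that $D'_\ast$ is a chain complex homotopy equivalent to $D_\ast$, and that there are bases of the $D_k$ in which the boundary of $D_\ast$ is the direct sum of the boundary of $D'_\ast$, identity matrices of sizes $|\mathcal{M}_k|$, and zero blocks. As long as some boundary matrix contains a unit entry, a nonempty Morse matching exists. Procedure. Given $C_\ast^{[i]}$ ($i\ge0$), repeatedly apply reductions over $R_{(p)}$ relative to nonempty Morse matchings until a complex $E_\ast$ is reached in which no boundary matrix contains a unit entry. Let $m_{k,i}$ be the sum of $|\mathcal{M}_k|$ over all Morse matchings $\mathcal{M}$ used in this passage from $C_\ast^{[i]}$ to $E_\ast$. If all boundary matrices of $E_\ast$ are zero, put $C_\ast^{[i+1]}=E_\ast$ and stop, with $t=i+1$. Otherwise let $p^{a_{i+1}}$ be the largest power of $p$ dividing all nonzero entries of all boundary matrices of $E_\ast$, and let $C_\ast^{[i+1]}$ be $E_\ast$ with all entries of all boundary matrices divided by $p^{a_{i+1}}$ (so $C_\ast^{[i+1]}$ contains unit entries); then continue. The $p$-torsion of an $R$-module is its submodule of elements annihilated by some power of $p$. *)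

theory Defs
  imports "HOL-Algebra.Algebraic_Closure_Type"
    "HOL-Computational_Algebra.Computational_Algebra"
begin

section \<open>Modules\<close>

text \<open>
  The record of modules extends that of rings, so it has fields \<open>mult\<close> and \<open>one\<close> which play no
  role for modules; quotients and direct sums leave them unspecified.
\<close>

definition module_morphisms ::
    "('r, 'x) ring_scheme \<Rightarrow> ('r, 'm, 'y) module_scheme \<Rightarrow> ('r, 'n, 'z) module_scheme \<Rightarrow> ('m \<Rightarrow> 'n) set"
  where "module_morphisms R M N =
    {f. f \<in> carrier M \<rightarrow> carrier N \<and>
        (\<forall>x \<in> carrier M. \<forall>y \<in> carrier M. f (x \<oplus>\<^bsub>M\<^esub> y) = f x \<oplus>\<^bsub>N\<^esub> f y) \<and>
        (\<forall>r \<in> carrier R. \<forall>x \<in> carrier M. f (r \<odot>\<^bsub>M\<^esub> x) = r \<odot>\<^bsub>N\<^esub> f x)}"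

definition module_isomorphic ::
    "('r, 'x) ring_scheme \<Rightarrow> ('r, 'm, 'y) module_scheme \<Rightarrow> ('r, 'n, 'z) module_scheme \<Rightarrow> bool"
  where "module_isomorphic R M N \<longleftrightarrow>
    (\<exists>f \<in> module_morphisms R M N. bij_betw f (carrier M) (carrier N))"

definition regular_module :: "('r, 'x) ring_scheme \<Rightarrow> ('r, 'r) module"
  where "regular_module R =
    \<lparr>carrier = carrier R, monoid.mult = monoid.mult R, one = one R,
     ring.zero = ring.zero R, ring.add = ring.add R, module.smult = monoid.mult R\<rparr>"

definition quotient_module :: "('r, 'm, 'y) module_scheme \<Rightarrow> 'm set \<Rightarrow> ('r, 'm set) module"
  where "quotient_module M N =
    \<lparr>carrier = a_rcosets\<^bsub>M\<^esub> N, monoid.mult = undefined, one = undefined,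
     ring.zero = N, ring.add = set_add M,
     module.smult = (\<lambda>r A. \<Union>x\<in>A. N +>\<^bsub>M\<^esub> (r \<odot>\<^bsub>M\<^esub> x))\<rparr>"

text \<open>For a finite index set the direct sum is the product.\<close>

definition finite_direct_sum ::
    "'j set \<Rightarrow> ('j \<Rightarrow> ('r, 'm, 'y) module_scheme) \<Rightarrow> ('r, 'j \<Rightarrow> 'm) module"
  where "finite_direct_sum J M =
    \<lparr>carrier = (\<Pi>\<^sub>E j\<in>J. carrier (M j)), monoid.mult = undefined, one = undefined,
     ring.zero = (\<lambda>j\<in>J. \<zero>\<^bsub>M j\<^esub>), ring.add = (\<lambda>f g. \<lambda>j\<in>J. f j \<oplus>\<^bsub>M j\<^esub> g j),
     module.smult = (\<lambda>r f. \<lambda>j\<in>J. r \<odot>\<^bsub>M j\<^esub> f j)\<rparr>"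

definition torsion_submodule ::
    "('r, 'x) ring_scheme \<Rightarrow> 'r \<Rightarrow> ('r, 'm, 'y) module_scheme \<Rightarrow> ('r, 'm, 'y) module_scheme"
  where "torsion_submodule R p M =
    M\<lparr>carrier := {x \<in> carrier M. \<exists>n::nat. (p [^]\<^bsub>R\<^esub> n) \<odot>\<^bsub>M\<^esub> x = \<zero>\<^bsub>M\<^esub>}\<rparr>"

definition is_coordinates ::
    "('r, 'x) ring_scheme \<Rightarrow> ('r, 'm, 'y) module_scheme \<Rightarrow> 'm set \<Rightarrow> 'm \<Rightarrow> ('m \<Rightarrow> 'r) \<Rightarrow> bool"
  where "is_coordinates R M B x c \<longleftrightarrow>
    c \<in> B \<rightarrow>\<^sub>E carrier R \<and> x = (\<Oplus>\<^bsub>M\<^esub>b\<in>B. c b \<odot>\<^bsub>M\<^esub> b)"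

definition finite_basis :: "('r, 'x) ring_scheme \<Rightarrow> ('r, 'm, 'y) module_scheme \<Rightarrow> 'm set \<Rightarrow> bool"
  where "finite_basis R M B \<longleftrightarrow>
    finite B \<and> B \<subseteq> carrier M \<and> (\<forall>x \<in> carrier M. \<exists>!c. is_coordinates R M B x c)"

definition coordinates ::
    "('r, 'x) ring_scheme \<Rightarrow> ('r, 'm, 'y) module_scheme \<Rightarrow> 'm set \<Rightarrow> 'm \<Rightarrow> 'm \<Rightarrow> 'r"
  where "coordinates R M B x = (THE c. is_coordinates R M B x c)"

section \<open>Chain complexes of modules\<close>

text \<open>
  The map \<open>d k\<close> goes from \<open>C k\<close> to \<open>C (k - 1)\<close> for \<open>k \<ge> 1\<close>; the function \<open>d 0\<close> is never used, the
  boundary of \<open>C 0\<close> being zero. A complex of length \<open>N\<close> is continued by zero modules.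
\<close>

definition chain_complex ::
    "('r, 'x) ring_scheme \<Rightarrow> nat \<Rightarrow> (nat \<Rightarrow> ('r, 'm) module) \<Rightarrow> (nat \<Rightarrow> 'm \<Rightarrow> 'm) \<Rightarrow> bool"
  where "chain_complex R N C d \<longleftrightarrow>
    (\<forall>k. Module.module R (C k)) \<and>
    (\<forall>k>N. carrier (C k) = {\<zero>\<^bsub>C k\<^esub>}) \<and>
    (\<forall>k\<ge>1. d k \<in> module_morphisms R (C k) (C (k - 1))) \<and>
    (\<forall>k\<ge>2. \<forall>x \<in> carrier (C k). d (k - 1) (d k x) = \<zero>\<^bsub>C (k - 2)\<^esub>)"

definition cycles :: "(nat \<Rightarrow> ('r, 'm) module) \<Rightarrow> (nat \<Rightarrow> 'm \<Rightarrow> 'm) \<Rightarrow> nat \<Rightarrow> 'm set"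
  where "cycles C d k = (if k = 0 then carrier (C 0) else a_kernel (C k) (C (k - 1)) (d k))"

definition homology ::
    "(nat \<Rightarrow> ('r, 'm) module) \<Rightarrow> (nat \<Rightarrow> 'm \<Rightarrow> 'm) \<Rightarrow> nat \<Rightarrow> ('r, 'm set) module"
  where "homology C d k =
    quotient_module ((C k)\<lparr>carrier := cycles C d k\<rparr>) (d (k + 1) ` carrier (C (k + 1)))"

section \<open>The localization at a prime\<close>

definition localization :: "'a::idom \<Rightarrow> 'a fract set"
  where "localization p = {Fract a b |a b. \<not> p dvd b}"

definition localization_unit :: "'a::idom \<Rightarrow> 'a fract \<Rightarrow> bool"
  where "localization_unit p x \<longleftrightarrow> x \<in> localization p \<and> (\<exists>y \<in> localization p. x * y = 1)"

definition localization_dvd :: "'a::idom \<Rightarrow> 'a fract \<Rightarrow> 'a fract \<Rightarrow> bool"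
  where "localization_dvd p x y \<longleftrightarrow> (\<exists>z \<in> localization p. y = x * z)"

section \<open>Based complexes and Morse matchings\<close>

text \<open>
  \<open>bdry D k u v\<close> is the entry of the \<open>k\<close>-th boundary matrix in row \<open>u\<close> and column \<open>v\<close>. It is
  meaningful only for \<open>k \<ge> 1\<close>, \<open>u \<in> basis D (k - 1)\<close> and \<open>v \<in> basis D k\<close>.
\<close>

record ('i, 'f) based_complex =
  basis :: "nat \<Rightarrow> 'i set"
  bdry :: "nat \<Rightarrow> 'i \<Rightarrow> 'i \<Rightarrow> 'f"

type_synonym 'i vertex = "nat \<times> 'i"

definition entries :: "('i, 'f) based_complex \<Rightarrow> 'f set"
  where "entries D = {bdry D k u v |k u v. 1 \<le> k \<and> u \<in> basis D (k - 1) \<and> v \<in> basis D k}"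

definition zero_boundaries :: "('i, 'f::zero) based_complex \<Rightarrow> bool"
  where "zero_boundaries D \<longleftrightarrow> (\<forall>x \<in> entries D. x = 0)"

definition has_unit_entry :: "'a::idom \<Rightarrow> ('i, 'a fract) based_complex \<Rightarrow> bool"
  where "has_unit_entry p D \<longleftrightarrow> (\<exists>x \<in> entries D. localization_unit p x)"

text \<open>
  The vertex set is the disjoint union of the bases, and an edge \<open>(x, y)\<close> is directed from \<open>x\<close> to
  \<open>y\<close>, that is, from a column to a row. There is at most one edge between two vertices, also after
  the reversal of a matching.
\<close>

definition edges :: "('i, 'f::zero) based_complex \<Rightarrow> ('i vertex \<times> 'i vertex) set"
  where "edges D = {((k, v), (k - 1, u)) |k u v.
    1 \<le> k \<and> u \<in> basis D (k - 1) \<and> v \<in> basis D k \<and> bdry D k u v \<noteq> 0}"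

fun edge_weight :: "('i, 'f) based_complex \<Rightarrow> 'i vertex \<times> 'i vertex \<Rightarrow> 'f"
  where "edge_weight D ((k, v), (l, u)) = bdry D k u v"

definition reversed_edges ::
    "('i, 'f::zero) based_complex \<Rightarrow> ('i vertex \<times> 'i vertex) set \<Rightarrow> ('i vertex \<times> 'i vertex) set"
  where "reversed_edges D \<M> = (edges D - \<M>) \<union> \<M>\<inverse>"

definition reversed_weight ::
    "('i, 'f::field) based_complex \<Rightarrow> ('i vertex \<times> 'i vertex) set \<Rightarrow> 'i vertex \<times> 'i vertex \<Rightarrow> 'f"
  where "reversed_weight D \<M> = (\<lambda>(x, y).
    if (y, x) \<in> \<M> then - 1 / edge_weight D (y, x) else edge_weight D (x, y))"

definition morse_matching ::
    "'a::idom \<Rightarrow> ('i, 'a fract) based_complex \<Rightarrow> ('i vertex \<times> 'i vertex) set \<Rightarrow> bool"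
  where "morse_matching p D \<M> \<longleftrightarrow>
    \<M> \<subseteq> edges D \<and>
    (\<forall>e \<in> \<M>. \<forall>f \<in> \<M>. e \<noteq> f \<longrightarrow> {fst e, snd e} \<inter> {fst f, snd f} = {}) \<and>
    (\<forall>e \<in> \<M>. localization_unit p (edge_weight D e)) \<and>
    acyclic (reversed_edges D \<M>)"

definition matching_part :: "('i vertex \<times> 'i vertex) set \<Rightarrow> nat \<Rightarrow> ('i vertex \<times> 'i vertex) set"
  where "matching_part \<M> k = {e \<in> \<M>. fst (fst e) = k}"

text \<open>A directed path is represented by the list of its vertices.\<close>

definition directed_paths :: "('v \<times> 'v) set \<Rightarrow> 'v \<Rightarrow> 'v \<Rightarrow> 'v list set"
  where "directed_paths E x y =
    {xs. xs \<noteq> [] \<and> hd xs = x \<and> last xs = y \<and> successively (\<lambda>a b. (a, b) \<in> E) xs}"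

definition path_weight :: "('v \<times> 'v \<Rightarrow> 'f::comm_monoid_mult) \<Rightarrow> 'v list \<Rightarrow> 'f"
  where "path_weight w xs = prod_list (map w (zip xs (tl xs)))"

text \<open>
  For a Morse matching on a complex with finitely many basis elements, acyclicity makes the set of
  paths finite, so that the sum below is a genuine one.
\<close>

definition morse_reduction ::
    "('i, 'f::field) based_complex \<Rightarrow> ('i vertex \<times> 'i vertex) set \<Rightarrow> ('i, 'f) based_complex"
  where "morse_reduction D \<M> =
    \<lparr>basis = (\<lambda>k. {v \<in> basis D k. \<forall>e \<in> \<M>. (k, v) \<notin> {fst e, snd e}}),
     bdry = (\<lambda>k u v. \<Sum>xs \<in> directed_paths (reversed_edges D \<M>) (k, v) (k - 1, u).
                path_weight (reversed_weight D \<M>) xs)\<rparr>"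

section \<open>The procedure\<close>

text \<open>
  \<open>repeated_reduction p D m E\<close>: \<open>E\<close> arises from \<open>D\<close> by successive reductions relative to nonempty
  Morse matchings, which have \<open>m k\<close> edges in degree \<open>k\<close> altogether.
\<close>

inductive repeated_reduction ::
    "'a::idom \<Rightarrow> ('i, 'a fract) based_complex \<Rightarrow> (nat \<Rightarrow> nat) \<Rightarrow> ('i, 'a fract) based_complex \<Rightarrow> bool"
  for p
  where
    refl: "repeated_reduction p D (\<lambda>k. 0) D"
  | step: "\<lbrakk>morse_matching p D \<M>; \<M> \<noteq> {}; repeated_reduction p (morse_reduction D \<M>) m E\<rbrakk>
      \<Longrightarrow> repeated_reduction p D (\<lambda>k. card (matching_part \<M> k) + m k) E"

definition largest_exponent :: "'a::idom \<Rightarrow> ('i, 'a fract) based_complex \<Rightarrow> nat \<Rightarrow> bool"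
  where "largest_exponent p D a \<longleftrightarrow>
    (\<forall>x \<in> entries D - {0}. localization_dvd p (to_fract p ^ a) x) \<and>
    (\<forall>b. (\<forall>x \<in> entries D - {0}. localization_dvd p (to_fract p ^ b) x) \<longrightarrow> b \<le> a)"

definition divide_boundaries ::
    "('i, 'f::field) based_complex \<Rightarrow> 'f \<Rightarrow> ('i, 'f) based_complex"
  where "divide_boundaries D c = D\<lparr>bdry := (\<lambda>k u v. bdry D k u v / c)\<rparr>"

text \<open>
  \<open>D i\<close> is the \<open>i\<close>-th complex of the sequence, \<open>E i\<close> the complex without unit entries reached from it, \<open>m k i\<close> the
  number of edges in degree \<open>k\<close> used in that passage, and \<open>a (Suc i)\<close> the exponent of the power of
  \<open>p\<close> by which \<open>E i\<close> is divided. The procedure is not deterministic, so this is a predicate on runs.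
  Nothing is required of the values of the sequences after the run has stopped.
\<close>

definition procedure_run ::
    "'a::idom \<Rightarrow> ('i, 'a fract) based_complex \<Rightarrow>
     (nat \<Rightarrow> ('i, 'a fract) based_complex) \<Rightarrow> (nat \<Rightarrow> ('i, 'a fract) based_complex) \<Rightarrow>
     (nat \<Rightarrow> nat \<Rightarrow> nat) \<Rightarrow> (nat \<Rightarrow> nat) \<Rightarrow> bool"
  where "procedure_run p D0 D E m a \<longleftrightarrow>
    D 0 = D0 \<and>
    (\<forall>i. (\<forall>j<i. \<not> zero_boundaries (E j)) \<longrightarrow>
       repeated_reduction p (D i) (\<lambda>k. m k i) (E i) \<and>
       \<not> has_unit_entry p (E i) \<and>
       (if zero_boundaries (E i) then D (Suc i) = E i
        else largest_exponent p (E i) (a (Suc i)) \<and>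
             D (Suc i) = divide_boundaries (E i) (to_fract p ^ a (Suc i))))"

definition stops_at :: "(nat \<Rightarrow> ('i, 'f::zero) based_complex) \<Rightarrow> nat \<Rightarrow> bool"
  where "stops_at E t \<longleftrightarrow>
    (\<exists>i. t = Suc i \<and> zero_boundaries (E i) \<and> (\<forall>j<i. \<not> zero_boundaries (E j)))"

definition localized_complex ::
    "(nat \<Rightarrow> ('a::idom, 'm) module) \<Rightarrow> (nat \<Rightarrow> 'm set) \<Rightarrow> (nat \<Rightarrow> 'm \<Rightarrow> 'm) \<Rightarrow> ('m, 'a fract) based_complex"
  where "localized_complex C I d =
    \<lparr>basis = I,
     bdry = (\<lambda>k u v. to_fract
       (coordinates ring_of_type_algebra (C (k - 1)) (I (k - 1)) (d k v) u))\<rparr>"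

end

theory Submission
  imports Defs
begin

text \<open>
  Write \<open>L\<close> for the localization. As \<open>C (k - 1)\<close> is torsion free, an element of \<open>C k\<close> which has a
  multiple by a power of \<open>p\<close> in the image of the boundary is a cycle. Hence the \<open>p\<close>-torsion of the
  homology in degree \<open>k\<close> is that of the cokernel of the single matrix from degree \<open>k + 1\<close> to degree
  \<open>k\<close>, and only the position of the image of this matrix inside the free module on the basis in
  degree \<open>k\<close> matters. Over \<open>L\<close> this position is recorded by a stacked basis: a linearly independent
  family \<open>y\<close> whose span is saturated (it contains \<open>z\<close> whenever it contains \<open>p z\<close>) such that the
  elements \<open>p ^ n j * y j\<close> span the image. The span of \<open>y\<close> then consists of all elements that are
  torsion modulo the image, and the torsion is the direct sum of the modules \<open>L / L p ^ n j\<close>.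

  Stacked bases are followed through the procedure from its end to its beginning. A zero matrix has
  the empty stacked basis. If all boundaries have been divided by \<open>p ^ a\<close>, then undoing the division
  adds \<open>a\<close> to all exponents (\<open>stacked_basis_scale\<close>). Undoing a reduction adjoins one element of
  exponent \<open>0\<close> for every edge of the matching in degree \<open>k + 1\<close> and keeps the other exponents
  (\<open>stacked_basis_reduction\<close>). So an edge used in the passage from the \<open>i\<close>-th complex collects the
  exponent \<open>a 1 + \<dots> + a i\<close>, which for \<open>i = 0\<close> contributes nothing.

  The heart is the effect of a reduction. Every basis element is critical, the top or the bottom of
  an edge of the matching. The block of the boundary matrix with the bottoms as rows and the tops as
  columns is square with units on the diagonal, and acyclicity makes it triangular; so it is
  invertible over \<open>L\<close> (\<open>bottoms_solvable\<close>, \<open>top_supported_zero\<close>). The sums over the paths that start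
  in a critical element \<open>v\<close> and end in the degree of \<open>v\<close> form the one chain that differs from \<open>v\<close> by
  tops and whose boundary vanishes at the bottoms; at the critical elements this boundary is a
  column of the reduced matrix. This lifting is a chain map from the reduced complex
  (\<open>boundary_lift_commute\<close>). The image of the boundary is spanned by the lifted image of the reduced
  boundary and by the columns of the matched tops, and the latter are detected by their entries at
  the bottoms.

  The procedure stops because a complex that was just divided has a unit entry, so that the passage
  to a complex without unit entries removes basis elements. Finally the ring \<open>L\<close> is replaced by the
  principal ideal domain: by Bezout an element which \<open>p\<close> does not divide is invertible modulo every
  power of \<open>p\<close>, so every residue class of \<open>L\<close> modulo \<open>p ^ n\<close> is represented in the domain, and
  denominators can be cleared without changing residue classes.
\<close>

section \<open>The localization as a ring\<close>

lemma localizationE: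
  assumes "x \<in> localization p"
  obtains a b where "\<not> p dvd b" "x = to_fract a / to_fract b" "to_fract b \<noteq> 0"
proof -
  obtain a b where ab: "\<not> p dvd b" "x = Fract a b"
    using assms by (auto simp: localization_def)
  then have "b \<noteq> 0" by auto
  with ab that show thesis by (auto simp: Fract_conv_to_fract)
qed

lemma localizationI: "\<not> p dvd b \<Longrightarrow> to_fract a / to_fract b \<in> localization p"
  unfolding localization_def by (auto simp: Fract_conv_to_fract[symmetric])

locale localization_at_prime =
  fixes p :: "'a::idom"
  assumes prime: "prime_elem p"
begin

abbreviation "L \<equiv> localization p"
abbreviation "\<pi> \<equiv> to_fract p"

lemma p_nonzero [simp]: "p \<noteq> 0"
  using prime by (auto simp: prime_elem_def)

lemma to_fract_in_L [simp, intro]: "to_fract x \<in> L"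
  using localizationI[of p 1 x] prime by (auto simp: prime_elem_def)

lemma zero_in_L [simp, intro]: "0 \<in> L" and one_in_L [simp, intro]: "1 \<in> L"
  using to_fract_in_L[of 0] to_fract_in_L[of 1] by simp_all

lemma add_in_L [intro]:
  assumes "x \<in> L" "y \<in> L"
  shows "x + y \<in> L"
proof -
  obtain a b where x: "\<not> p dvd b" "x = to_fract a / to_fract b" "to_fract b \<noteq> 0"
    using assms(1) by (rule localizationE)
  obtain c e where y: "\<not> p dvd e" "y = to_fract c / to_fract e" "to_fract e \<noteq> 0"
    using assms(2) by (rule localizationE)
  have "x + y = to_fract (a * e + c * b) / to_fract (b * e)"
    using x(2,3) y(2,3) by (simp add: field_simps)
  then show ?thesis
    using x(1) y(1) prime by (simp only: localizationI prime_elem_dvd_mult_iff simp_thms)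
qed

lemma mult_in_L [intro]:
  assumes "x \<in> L" "y \<in> L"
  shows "x * y \<in> L"
proof -
  obtain a b where x: "\<not> p dvd b" "x = to_fract a / to_fract b" "to_fract b \<noteq> 0"
    using assms(1) by (rule localizationE)
  obtain c e where y: "\<not> p dvd e" "y = to_fract c / to_fract e" "to_fract e \<noteq> 0"
    using assms(2) by (rule localizationE)
  have "x * y = to_fract (a * c) / to_fract (b * e)"
    using x(2,3) y(2,3) by (simp add: field_simps)
  then show ?thesis
    using x(1) y(1) prime by (simp only: localizationI prime_elem_dvd_mult_iff simp_thms)
qed

lemma minus_in_L [intro]: "x \<in> L \<Longrightarrow> - x \<in> L"
  using mult_in_L[of "to_fract (- 1)" x] to_fract_in_L[of "- 1"] by simp

lemma diff_in_L [intro]: "x \<in> L \<Longrightarrow> y \<in> L \<Longrightarrow> x - y \<in> L"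
  using add_in_L[of x "- y"] by auto

lemma power_in_L [intro]: "x \<in> L \<Longrightarrow> x ^ n \<in> L"
  by (induction n) auto

lemma sum_in_L [intro]: "(\<And>i. i \<in> A \<Longrightarrow> f i \<in> L) \<Longrightarrow> sum f A \<in> L"
  by (induction A rule: infinite_finite_induct) auto

lemma localization_unitD:
  assumes "localization_unit p x"
  shows "x \<in> L" "x \<noteq> 0" "1 / x \<in> L"
proof -
  obtain y where "x \<in> L" "y \<in> L" "x * y = 1"
    using assms by (auto simp: localization_unit_def)
  moreover from this have "x \<noteq> 0" by auto
  moreover from calculation have "1 / x = y" by (simp add: field_simps)
  ultimately show "x \<in> L" "x \<noteq> 0" "1 / x \<in> L" by auto
qed

text \<open>
  The localization is a local ring whose maximal ideal is generated by \<open>p\<close>: a numerator which \<open>p\<close>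
  does not divide may serve as a denominator.
\<close>

lemma nonunit_is_multiple:
  assumes "x \<in> L" "\<not> localization_unit p x"
  obtains y where "y \<in> L" "x = \<pi> * y"
proof -
  obtain a b where x: "\<not> p dvd b" "x = to_fract a / to_fract b" "to_fract b \<noteq> 0"
    using assms(1) by (rule localizationE)
  have "p dvd a"
  proof (rule ccontr)
    assume a: "\<not> p dvd a"
    then have "to_fract a \<noteq> 0" by auto
    then have "x * (to_fract b / to_fract a) = 1" using x by simp
    then show False
      using assms localizationI[OF a] unfolding localization_unit_def by blast
  qed
  then obtain c where "a = p * c" by auto
  then have "x = \<pi> * (to_fract c / to_fract b)" using x by simp
  then show thesis using that localizationI[OF x(1)] by blast
qed

end

section \<open>Path sums in acyclic digraphs\<close>

definition path_sum :: "('v \<times> 'v) set \<Rightarrow> ('v \<times> 'v \<Rightarrow> 'f::comm_ring_1) \<Rightarrow> 'v \<Rightarrow> 'v \<Rightarrow> 'f"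
  where "path_sum E w x y = (\<Sum>xs \<in> directed_paths E x y. path_weight w xs)"

lemma directed_paths_last_edge:
  "directed_paths E x y = (if x = y then {[x]} else {}) \<union>
     (\<Union>z \<in> {z. (z, y) \<in> E}. (\<lambda>xs. xs @ [y]) ` directed_paths E x z)" (is "?l = ?r")
proof
  show "?l \<subseteq> ?r"
  proof
    fix xs assume xs: "xs \<in> ?l"
    then obtain ys where ys: "xs = ys @ [y]"
      by (auto simp: directed_paths_def) (metis append_butlast_last_id)
    show "xs \<in> ?r"
    proof (cases "ys = []")
      case True
      with xs ys show ?thesis by (auto simp: directed_paths_def)
    next
      case False
      with xs ys have "(last ys, y) \<in> E" "ys \<in> directed_paths E x (last ys)"
        by (auto simp: directed_paths_def successively_append_iff)
      with ys show ?thesis by auto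
    qed
  qed
  show "?r \<subseteq> ?l"
    by (auto simp: directed_paths_def successively_append_iff split: if_splits)
qed

lemma finite_directed_paths:
  assumes "finite E" "acyclic E"
  shows "finite (directed_paths E x y)"
proof -
  have "wf E" using assms by (rule finite_acyclic_wf)
  then show ?thesis
  proof (induction y)
    case (less y)
    have "finite {z. (z, y) \<in> E}"
      by (rule finite_subset[OF _ finite_imageI[OF assms(1), of fst]]) force
    then show ?case
      using less by (subst directed_paths_last_edge) auto
  qed
qed

lemma path_weight_snoc:
  assumes "xs \<noteq> []"
  shows "path_weight w (xs @ [y]) = path_weight w xs * w (last xs, y)"
proof -
  have "zip (xs @ [y]) (tl (xs @ [y])) = zip xs (tl xs) @ [(last xs, y)]"
    using assms
  proof (induction xs)
    case (Cons a xs)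
    then show ?case by (cases xs) auto
  qed simp
  then show ?thesis by (simp add: path_weight_def)
qed

text \<open>
  Acyclicity and finiteness are needed for the set of paths to be finite: otherwise the sum would
  silently be zero and the recurrence would fail.
\<close>

lemma path_sum_last_edge:
  assumes "finite E" "acyclic E"
  shows "path_sum E w x y =
    (if x = y then 1 else 0) + (\<Sum>z | (z, y) \<in> E. path_sum E w x z * w (z, y))"
proof -
  let ?P = "\<lambda>z. (\<lambda>xs. xs @ [y]) ` directed_paths E x z"
  have fin: "finite {z. (z, y) \<in> E}"
    by (rule finite_subset[OF _ finite_imageI[OF assms(1), of fst]]) force
  note finp = finite_directed_paths[OF assms]
  have "path_sum E w x y = (\<Sum>xs \<in> (if x = y then {[x]} else {}). path_weight w xs)
      + (\<Sum>xs \<in> (\<Union>z \<in> {z. (z, y) \<in> E}. ?P z). path_weight w xs)"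
    unfolding path_sum_def
    by (subst directed_paths_last_edge, rule sum.union_disjoint)
      (use fin finp in \<open>auto simp: directed_paths_def\<close>)
  also have "(\<Sum>xs \<in> (\<Union>z \<in> {z. (z, y) \<in> E}. ?P z). path_weight w xs)
      = (\<Sum>z | (z, y) \<in> E. \<Sum>xs \<in> ?P z. path_weight w xs)"
    by (rule sum.UNION_disjoint) (use fin finp in \<open>auto simp: directed_paths_def\<close>)
  also have "\<dots> = (\<Sum>z | (z, y) \<in> E. path_sum E w x z * w (z, y))"
  proof (rule sum.cong[OF HOL.refl])
    fix z assume "z \<in> {z. (z, y) \<in> E}"
    have "(\<Sum>xs \<in> ?P z. path_weight w xs) = (\<Sum>xs \<in> directed_paths E x z. path_weight w (xs @ [y]))"
      by (subst sum.reindex) (auto simp: inj_on_def)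
    also have "\<dots> = (\<Sum>xs \<in> directed_paths E x z. path_weight w xs * w (z, y))"
      by (rule sum.cong) (auto simp: directed_paths_def path_weight_snoc)
    finally show "(\<Sum>xs \<in> ?P z. path_weight w xs) = path_sum E w x z * w (z, y)"
      by (simp add: path_sum_def sum_distrib_right)
  qed
  also have "(\<Sum>xs \<in> (if x = y then {[x]} else {}). path_weight w xs) = (if x = y then 1 else 0)"
    by (simp add: path_weight_def)
  finally show ?thesis .
qed

text \<open>
  Used to show that path sums vanish at vertices that cannot be reached.
\<close>

lemma path_sum_invariant:
  assumes "path_sum E w x y \<noteq> 0" "Q x" "\<And>a b. (a, b) \<in> E \<Longrightarrow> Q a \<Longrightarrow> Q b"
  shows "Q y"
proof -
  obtain xs where "xs \<in> directed_paths E x y"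
    using assms(1) unfolding path_sum_def by (metis sum.empty all_not_in_conv)
  then have "xs \<noteq> []" "hd xs = x" "last xs = y" "successively (\<lambda>a b. (a, b) \<in> E) xs"
    by (auto simp: directed_paths_def)
  then show ?thesis
    using assms(2)
  proof (induction xs arbitrary: x)
    case (Cons a xs)
    then show ?case using assms(3) by (cases xs) auto
  qed simp
qed

text \<open>
  The boundary in degree \<open>k\<close> has its rows in degree \<open>k - 1\<close>. Rewriting \<open>1\<close> to \<open>Suc 0\<close> would destroy
  this form.
\<close>

declare One_nat_def [simp del]

section \<open>Chains over the localization\<close>

text \<open>
  With the value zero in degree \<open>0\<close>, the law that the square of the boundary vanishes needs no
  restriction of the degree.
\<close>

definition boundary :: "('i, 'f::field) based_complex \<Rightarrow> nat \<Rightarrow> ('i \<Rightarrow> 'f) \<Rightarrow> 'i \<Rightarrow> 'f"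
  where "boundary D k z u =
    (if 1 \<le> k \<and> u \<in> basis D (k - 1) then \<Sum>v \<in> basis D k. bdry D k u v * z v else 0)"

text \<open>
  Chains vanish outside the basis, so that equality of chains is equality of functions.
\<close>

definition chains :: "'a::idom \<Rightarrow> ('i, 'a fract) based_complex \<Rightarrow> nat \<Rightarrow> ('i \<Rightarrow> 'a fract) set"
  where "chains p D k = {z. (\<forall>x. z x \<in> localization p) \<and> (\<forall>x. x \<notin> basis D k \<longrightarrow> z x = 0)}"

lemma boundary_cong:
  "(\<And>x. x \<in> basis D k \<Longrightarrow> y x = z x) \<Longrightarrow> boundary D k y = boundary D k z"
  by (auto simp: boundary_def fun_eq_iff intro!: sum.cong)

lemma boundary_add: "boundary D k (\<lambda>x. y x + z x) u = boundary D k y u + boundary D k z u"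
  by (simp add: boundary_def algebra_simps sum.distrib)

lemma boundary_diff: "boundary D k (\<lambda>x. y x - z x) u = boundary D k y u - boundary D k z u"
  by (simp add: boundary_def algebra_simps sum_subtractf)

lemma boundary_scale: "boundary D k (\<lambda>x. c * z x) u = c * boundary D k z u"
  by (simp add: boundary_def sum_distrib_left mult.left_commute)

lemma boundary_zero [simp]: "boundary D k (\<lambda>x. 0) u = 0"
  by (simp add: boundary_def)

lemma boundary_sum: "boundary D k (\<lambda>x. \<Sum>j\<in>J. y j x) u = (\<Sum>j\<in>J. boundary D k (y j) u)"
  by (induction J rule: infinite_finite_induct) (simp_all add: boundary_add)

lemma boundary_outside: "u \<notin> basis D (k - 1) \<Longrightarrow> boundary D k z u = 0"
  by (simp add: boundary_def)

text \<open>
  The square of the boundary vanishes for all functions with values in the fraction field; those with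
  values in the localization would give the same condition, as denominators can be cleared.
\<close>

locale local_complex = localization_at_prime p for p :: "'a::idom" +
  fixes D :: "('i, 'a fract) based_complex"
  assumes finite_basis [simp]: "finite (basis D k)"
    and bounded: "\<exists>N. \<forall>k>N. basis D k = {}"
    and entries_in_L: "\<lbrakk>1 \<le> k; u \<in> basis D (k - 1); v \<in> basis D k\<rbrakk> \<Longrightarrow> bdry D k u v \<in> L"
    and boundary_boundary [simp]: "boundary D k (boundary D (Suc k) z) u = 0"
begin

lemma boundary_in_chains:
  "z \<in> chains p D k \<Longrightarrow> boundary D k z \<in> chains p D (k - 1)"
  by (auto simp: chains_def boundary_def intro!: sum_in_L mult_in_L entries_in_L)

lemma finite_edges: "finite (edges D)"
proof -
  obtain N where N: "\<And>k. k > N \<Longrightarrow> basis D k = {}" using bounded by blast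
  let ?V = "\<Union>k \<in> {..N}. Pair k ` basis D k"
  have V: "(k, v) \<in> ?V" if "v \<in> basis D k" for k v
    using that N[of k] by (cases "k \<le> N") auto
  have "edges D \<subseteq> ?V \<times> ?V"
    by (rule subsetI) (use V in \<open>auto simp only: edges_def mem_Collect_eq mem_Sigma_iff\<close>)
  then show ?thesis by (rule finite_subset) auto
qed

end

section \<open>Stacked bases\<close>

definition combination :: "'j set \<Rightarrow> ('j \<Rightarrow> 'i \<Rightarrow> 'f::comm_ring_1) \<Rightarrow> ('j \<Rightarrow> 'f) \<Rightarrow> 'i \<Rightarrow> 'f"
  where "combination J y r x = (\<Sum>j\<in>J. r j * y j x)"

text \<open>
  The name follows the stacked bases theorem: the family spans the saturation of the image of the
  boundary from degree \<open>k + 1\<close>, and its multiples by powers of \<open>p\<close> span the image itself. Independence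
  is required over the fraction field, where it can be tested without looking at denominators.
\<close>

definition stacked_basis ::
    "'a::idom \<Rightarrow> ('i, 'a fract) based_complex \<Rightarrow> nat \<Rightarrow> 'j set \<Rightarrow> ('j \<Rightarrow> nat) \<Rightarrow> ('j \<Rightarrow> 'i \<Rightarrow> 'a fract) \<Rightarrow> bool"
  where "stacked_basis p D k J n y \<longleftrightarrow>
    finite J \<and> (\<forall>j\<in>J. y j \<in> chains p D k) \<and>
    (\<forall>r. combination J y r = (\<lambda>x. 0) \<longrightarrow> (\<forall>j\<in>J. r j = 0)) \<and>
    (\<forall>z \<in> chains p D k. (\<exists>r. range r \<subseteq> localization p \<and> (\<lambda>x. to_fract p * z x) = combination J y r) \<longrightarrow>
       (\<exists>r. range r \<subseteq> localization p \<and> z = combination J y r)) \<and>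
    boundary D (Suc k) ` chains p D (Suc k) =
      {combination J y (\<lambda>j. r j * to_fract p ^ n j) |r. range r \<subseteq> localization p}"

lemma combination_cong:
  "(\<And>j. j \<in> J \<Longrightarrow> r j = s j) \<Longrightarrow> combination J y r = combination J y s"
  by (simp add: combination_def fun_eq_iff)

lemma combination_add:
  "combination J y (\<lambda>j. r j + s j) x = combination J y r x + combination J y s x"
  by (simp add: combination_def algebra_simps sum.distrib)

lemma combination_scale: "combination J y (\<lambda>j. c * r j) x = c * combination J y r x"
  by (simp add: combination_def sum_distrib_left mult.assoc)

section \<open>The reduction relative to a Morse matching\<close>

locale matched_complex = local_complex p D
  for p :: "'a::idom" and D :: "('i, 'a fract) based_complex" +
  fixes \<M> :: "('i vertex \<times> 'i vertex) set"
  assumes morse: "morse_matching p D \<M>"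
begin

text \<open>
  The vertex \<open>v\<close> is the top and \<open>u\<close> the bottom of an edge of the matching. In degree \<open>0\<close> there is no
  such edge, so the truncated \<open>k - 1\<close> does no harm.
\<close>

definition matched :: "nat \<Rightarrow> 'i \<Rightarrow> 'i \<Rightarrow> bool"
  where "matched k v u \<longleftrightarrow> ((k, v), (k - 1, u)) \<in> \<M>"

text \<open>
  Below, \<open>h s k x\<close> is the sum of the weights of all paths from the vertex \<open>s\<close> to the basis element \<open>x\<close>
  in degree \<open>k\<close>, in the graph \<open>E\<close> with the matching reversed.
\<close>

abbreviation "D' \<equiv> morse_reduction D \<M>"
abbreviation "E \<equiv> reversed_edges D \<M>"
abbreviation "w \<equiv> reversed_weight D \<M>"

abbreviation h :: "'i vertex \<Rightarrow> nat \<Rightarrow> 'i \<Rightarrow> 'a fract"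
  where "h s k x \<equiv> path_sum E w s (k, x)"

lemma matchedD:
  assumes "matched k v u"
  shows "1 \<le> k" "u \<in> basis D (k - 1)" "v \<in> basis D k" "localization_unit p (bdry D k u v)"
proof -
  have "((k, v), (k - 1, u)) \<in> edges D"
    using assms morse by (auto simp: matched_def morse_matching_def)
  then show "1 \<le> k" "u \<in> basis D (k - 1)" "v \<in> basis D k"
    by (auto simp: edges_def)
  have "localization_unit p (edge_weight D ((k, v), (k - 1, u)))"
    using assms morse unfolding matched_def morse_matching_def by blast
  then show "localization_unit p (bdry D k u v)" by simp
qed

lemma matched_nonzero: "matched k v u \<Longrightarrow> bdry D k u v \<noteq> 0"
  using matchedD(4) localization_unitD(2) by blast

lemma matching_edge:
  assumes "((k, v), (l, u)) \<in> \<M>"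
  shows "l = k - 1" "matched k v u"
proof -
  have "((k, v), (l, u)) \<in> edges D"
    using assms morse by (auto simp: morse_matching_def)
  then show "l = k - 1" by (auto simp: edges_def)
  with assms show "matched k v u" by (simp add: matched_def)
qed

lemma matched_disjoint:
  assumes "e \<in> \<M>" "f \<in> \<M>" "{fst e, snd e} \<inter> {fst f, snd f} \<noteq> {}"
  shows "e = f"
  using assms morse unfolding morse_matching_def by blast

lemma matched_unique_bottom: "matched k v u \<Longrightarrow> matched k v u' \<Longrightarrow> u = u'"
  using matched_disjoint[of "((k, v), (k - 1, u))" "((k, v), (k - 1, u'))"]
  by (auto simp: matched_def)

lemma matched_unique_top: "matched k v u \<Longrightarrow> matched k v' u \<Longrightarrow> v = v'"
  using matched_disjoint[of "((k, v), (k - 1, u))" "((k, v'), (k - 1, u))"]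
  by (auto simp: matched_def)

lemma matched_top_not_bottom:
  assumes "matched k v u"
  shows "\<not> matched (Suc k) v' v"
proof
  assume "matched (Suc k) v' v"
  then have "((k, v), (k - 1, u)) = ((Suc k, v'), (k, v))"
    using assms matched_disjoint[of "((k, v), (k - 1, u))" "((Suc k, v'), (k, v))"]
    by (simp add: matched_def)
  then show False by simp
qed

lemma basis_reduction:
  "basis D' k = {v \<in> basis D k. (\<forall>u. \<not> matched k v u) \<and> (\<forall>v'. \<not> matched (Suc k) v' v)}"
proof -
  have "(\<forall>e\<in>\<M>. (k, v) \<notin> {fst e, snd e}) \<longleftrightarrow>
      (\<forall>u. \<not> matched k v u) \<and> (\<forall>v'. \<not> matched (Suc k) v' v)" for v
  proof
    assume "\<forall>e\<in>\<M>. (k, v) \<notin> {fst e, snd e}"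
    then show "(\<forall>u. \<not> matched k v u) \<and> (\<forall>v'. \<not> matched (Suc k) v' v)"
      by (fastforce simp: matched_def)
  next
    assume un: "(\<forall>u. \<not> matched k v u) \<and> (\<forall>v'. \<not> matched (Suc k) v' v)"
    show "\<forall>e\<in>\<M>. (k, v) \<notin> {fst e, snd e}"
    proof
      fix e assume "e \<in> \<M>"
      moreover obtain k1 v1 l1 u1 where e: "e = ((k1, v1), (l1, u1))" by (metis prod.collapse)
      ultimately have "l1 = k1 - 1" "matched k1 v1 u1" using matching_edge by blast+
      moreover have "1 \<le> k1" using calculation(2) by (rule matchedD)
      ultimately show "(k, v) \<notin> {fst e, snd e}" using un e by auto
    qed
  qed
  then show ?thesis by (simp add: morse_reduction_def)
qed

lemma basis_reduction_subset: "basis D' k \<subseteq> basis D k"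
  by (auto simp: basis_reduction)

lemma finite_basis' [simp]: "finite (basis D' k)"
  by (rule finite_subset[OF basis_reduction_subset]) simp

lemma bdry_reduction: "bdry D' k u v = h (k, v) (k - 1) u"
  by (simp add: morse_reduction_def path_sum_def)

lemma finite_E: "finite E"
  using finite_edges morse
  by (auto simp: reversed_edges_def morse_matching_def intro: finite_subset)

lemma acyclic_E: "acyclic E"
  using morse by (simp add: morse_matching_def)

lemma predecessors:
  "(z, (k, x)) \<in> E \<longleftrightarrow>
    (\<exists>v. z = (Suc k, v) \<and> x \<in> basis D k \<and> v \<in> basis D (Suc k) \<and> bdry D (Suc k) x v \<noteq> 0 \<and>
         \<not> matched (Suc k) v x) \<or>
    (\<exists>u. z = (k - 1, u) \<and> matched k x u)" (is "?l \<longleftrightarrow> ?r")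
proof
  assume ?l
  then consider "(z, (k, x)) \<in> edges D" "(z, (k, x)) \<notin> \<M>" | "((k, x), z) \<in> \<M>"
    by (auto simp: reversed_edges_def)
  then show ?r
  proof cases
    case 1
    then show ?thesis by (auto simp: edges_def matched_def)
  next
    case 2
    then show ?thesis using matching_edge by (cases z) auto
  qed
next
  assume ?r
  then show ?l
    by (auto simp: reversed_edges_def edges_def matched_def)
qed

lemma weight_down: "w ((Suc k, v), (k, x)) = bdry D (Suc k) x v"
proof -
  have "((k, x), (Suc k, v)) \<notin> \<M>"
    using matching_edge(1)[of k x "Suc k" v] by auto
  then show ?thesis by (simp add: reversed_weight_def)
qed

lemma weight_up: "matched k x u \<Longrightarrow> w ((k - 1, u), (k, x)) = - 1 / bdry D k u x"
  by (simp add: reversed_weight_def matched_def)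

lemma h_recurrence:
  "h s k x = (if s = (k, x) then 1 else 0)
    + (if x \<in> basis D k
       then \<Sum>v | v \<in> basis D (Suc k) \<and> \<not> matched (Suc k) v x. bdry D (Suc k) x v * h s (Suc k) v
       else 0)
    + (\<Sum>u | matched k x u. h s (k - 1) u * (- 1 / bdry D k u x))"
proof -
  let ?V = "{v. x \<in> basis D k \<and> v \<in> basis D (Suc k) \<and> bdry D (Suc k) x v \<noteq> 0 \<and> \<not> matched (Suc k) v x}"
  let ?U = "{u. matched k x u}"
  have pre: "{z. (z, (k, x)) \<in> E} = Pair (Suc k) ` ?V \<union> Pair (k - 1) ` ?U"
    by (auto simp: predecessors)
  have fin: "finite ?V" "finite ?U"
    using finite_subset[OF _ finite_basis[of "Suc k"], of ?V]
      finite_subset[OF _ finite_basis[of "k - 1"], of ?U] matchedD(2) by auto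
  have "h s k x = (if s = (k, x) then 1 else 0) + (\<Sum>z | (z, (k, x)) \<in> E. path_sum E w s z * w (z, (k, x)))"
    by (rule path_sum_last_edge[OF finite_E acyclic_E])
  also have "(\<Sum>z | (z, (k, x)) \<in> E. path_sum E w s z * w (z, (k, x)))
      = (\<Sum>z \<in> Pair (Suc k) ` ?V. path_sum E w s z * w (z, (k, x)))
      + (\<Sum>z \<in> Pair (k - 1) ` ?U. path_sum E w s z * w (z, (k, x)))"
    unfolding pre by (rule sum.union_disjoint) (use fin in auto)
  also have "(\<Sum>z \<in> Pair (Suc k) ` ?V. path_sum E w s z * w (z, (k, x)))
      = (\<Sum>v \<in> ?V. bdry D (Suc k) x v * h s (Suc k) v)"
    by (subst sum.reindex) (auto simp: inj_on_def weight_down mult.commute)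
  also have "\<dots> = (if x \<in> basis D k
       then \<Sum>v | v \<in> basis D (Suc k) \<and> \<not> matched (Suc k) v x. bdry D (Suc k) x v * h s (Suc k) v
       else 0)"
    by (auto intro!: sum.mono_neutral_left)
  also have "(\<Sum>z \<in> Pair (k - 1) ` ?U. path_sum E w s z * w (z, (k, x)))
      = (\<Sum>u | matched k x u. h s (k - 1) u * (- 1 / bdry D k u x))"
    by (subst sum.reindex) (auto simp: inj_on_def weight_up)
  finally show ?thesis by (simp add: add.assoc)
qed

lemma h_in_L: "h s k x \<in> L"
proof -
  have "wf E" using finite_E acyclic_E by (rule finite_acyclic_wf)
  then have "path_sum E w s y \<in> L" for y
  proof (induction y)
    case (less y)
    have "w (z, y) \<in> L" if "(z, y) \<in> E" for z
    proof (cases y)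
      case (Pair k x)
      with that consider
          v where "z = (Suc k, v)" "x \<in> basis D k" "v \<in> basis D (Suc k)"
        | u where "z = (k - 1, u)" "matched k x u"
        by (auto simp: predecessors)
      then show ?thesis
      proof cases
        case 1
        then show ?thesis using Pair entries_in_L[of "Suc k" x v] by (simp add: weight_down)
      next
        case 2
        then have "1 / bdry D k u x \<in> L" using matchedD(4) localization_unitD(3) by blast
        then have "- (1 / bdry D k u x) \<in> L" by (rule minus_in_L)
        then show ?thesis using 2 Pair by (simp add: weight_up)
      qed
    qed
    then show ?case
      using less by (subst path_sum_last_edge[OF finite_E acyclic_E]) (auto intro!: add_in_L sum_in_L mult_in_L)
  qed
  then show ?thesis .
qed

text \<open>
  A path can rise only along a reversed edge, and it then arrives at a top, which is not a bottom; so it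
  cannot rise twice in succession. Hence a path that starts in degree \<open>k\<close> at a vertex which is not a
  bottom, or below degree \<open>k\<close>, never reaches degree \<open>k + 1\<close>. The following property of vertices is the
  invariant that shows this.
\<close>

definition low :: "nat \<Rightarrow> 'i vertex \<Rightarrow> bool"
  where "low k s \<longleftrightarrow> fst s < k \<or> fst s = k \<and> (\<forall>v. \<not> matched (Suc k) v (snd s))"

lemma low_edge:
  assumes "(a, b) \<in> E" "low k a"
  shows "low k b"
proof (cases b)
  case (Pair l x)
  with assms(1) consider v where "a = (Suc l, v)" | u where "a = (l - 1, u)" "matched l x u"
    by (auto simp: predecessors)
  then show ?thesis
  proof cases
    case 1
    then show ?thesis using assms(2) Pair by (auto simp: low_def)
  next
    case 2
    have "1 \<le> l" using 2(2) by (rule matchedD)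
    with 2 assms(2) have "l \<le> k" by (cases "l = Suc k") (auto simp: low_def)
    then show ?thesis using 2 Pair matched_top_not_bottom by (auto simp: low_def)
  qed
qed

lemma h_above: "low k s \<Longrightarrow> h s (Suc k) x = 0"
  using path_sum_invariant[of E w s "(Suc k, x)" "low k"] low_edge by (auto simp: low_def)

lemma h_not_top:
  assumes "low k s" "\<And>u. \<not> matched k x u"
  shows "h s k x = (if s = (k, x) then 1 else 0)"
proof -
  have "{u. matched k x u} = {}" using assms(2) by simp
  then show ?thesis using assms(1) by (subst h_recurrence) (simp add: h_above del: Collect_empty_eq)
qed

lemma h_top:
  assumes "low k s" "matched k v u" "s \<noteq> (k, v)"
  shows "bdry D k u v * h s k v = - h s (k - 1) u"
proof -
  have "{u. matched k v u} = {u}" using assms(2) matched_unique_bottom by auto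
  then have "h s k v = h s (k - 1) u * (- 1 / bdry D k u v)"
    using assms by (subst h_recurrence) (simp add: h_above)
  then show ?thesis using matched_nonzero[OF assms(2)] by simp
qed

text \<open>
  The recurrence of the path sums at a vertex \<open>u\<close> of degree \<open>k - 1\<close> runs over all entries of the row of
  \<open>u\<close> but the one of the matched edge, if there is one. For a bottom \<open>u\<close> this missing entry is supplied
  by the recurrence at the top, where the weight \<open>- 1 / w\<close> is what makes the whole row cancel.
\<close>

lemma boundary_h:
  assumes "low k s" "\<And>v u. matched k v u \<Longrightarrow> s \<noteq> (k, v)"
    and "1 \<le> k" "u \<in> basis D (k - 1)" "\<And>t. \<not> matched (k - 1) u t"
  shows "boundary D k (h s k) u = (if \<exists>v. matched k v u then 0 else h s (k - 1) u)
    - (if s = (k - 1, u) then 1 else 0)"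
proof -
  have k: "Suc (k - 1) = k" using assms(3) by simp
  let ?N = "{v. v \<in> basis D k \<and> \<not> matched k v u}" and ?T = "{v. v \<in> basis D k \<and> matched k v u}"
  have rest: "h s (k - 1) u = (if s = (k - 1, u) then 1 else 0) + (\<Sum>v \<in> ?N. bdry D k u v * h s k v)"
    using h_recurrence[of s "k - 1" u] assms(4,5) unfolding k by simp
  have "boundary D k (h s k) u = (\<Sum>v \<in> ?N \<union> ?T. bdry D k u v * h s k v)"
    using assms(3,4) by (auto simp: boundary_def intro!: sum.cong)
  also have "\<dots> = (\<Sum>v \<in> ?N. bdry D k u v * h s k v) + (\<Sum>v \<in> ?T. bdry D k u v * h s k v)"
    by (rule sum.union_disjoint) auto
  also have "(\<Sum>v \<in> ?T. bdry D k u v * h s k v) = (if \<exists>v. matched k v u then - h s (k - 1) u else 0)"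
  proof (cases "\<exists>v. matched k v u")
    case True
    then obtain v where v: "matched k v u" by blast
    then have "?T = {v}" using matched_unique_top matchedD(3) by blast
    then show ?thesis using v h_top[OF assms(1) v assms(2)[OF v]] by auto
  qed simp
  finally show ?thesis using rest by auto
qed

definition top_supported :: "nat \<Rightarrow> ('i \<Rightarrow> 'a fract) \<Rightarrow> bool"
  where "top_supported k z \<longleftrightarrow> (\<forall>x. (\<forall>u. \<not> matched k x u) \<longrightarrow> z x = 0)"

text \<open>
  The block of the boundary matrix between tops and bottoms is surjective over the localization: up to
  sign, the path sums from a bottom to the tops are a preimage of the corresponding basis element.
\<close>

lemma bottoms_solvable:
  assumes "\<And>x. c x \<in> L"
  obtains z where "z \<in> chains p D k" "top_supported k z"
    "\<And>v u. matched k v u \<Longrightarrow> boundary D k z u = c u"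
proof -
  let ?B = "{u \<in> basis D (k - 1). \<exists>v. matched k v u}"
  \<comment> \<open>The sign undoes the sign in the boundary of the path sums that start in a bottom.\<close>
  define z where "z = (\<lambda>x. \<Sum>b\<in>?B. - c b * h (k - 1, b) k x)"
  have low: "low k (k - 1, b)" if b: "b \<in> ?B" for b
  proof -
    obtain v where "matched k v b" using b by blast
    from matchedD(1)[OF this] show ?thesis by (simp add: low_def)
  qed
  have nt: "h (k - 1, b) k x = 0" if b: "b \<in> ?B" and x: "\<And>u. \<not> matched k x u" for b x
  proof -
    obtain v where "matched k v b" using b by blast
    then have "k - 1 \<noteq> k" using matchedD(1)[of k v b] by (cases k) simp_all
    then show ?thesis using h_not_top[OF low[OF b] x] by simp
  qed
  have top: "top_supported k z"
    by (simp add: top_supported_def z_def nt)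
  have chain: "z \<in> chains p D k"
    using top matchedD(3)
    by (fastforce simp: chains_def top_supported_def z_def intro!: sum_in_L mult_in_L minus_in_L assms h_in_L)
  have bot: "boundary D k z u = c u" if m: "matched k v u" for v u
  proof -
    have "boundary D k z u = (\<Sum>b\<in>?B. - c b * boundary D k (h (k - 1, b) k) u)"
      unfolding z_def by (simp only: boundary_sum boundary_scale)
    also have "\<dots> = (\<Sum>b\<in>?B. if b = u then c b else 0)"
    proof (rule sum.cong[OF HOL.refl])
      fix b assume b: "b \<in> ?B"
      have "boundary D k (h (k - 1, b) k) u = - (if b = u then 1 else 0)"
      proof (subst boundary_h)
        show "low k (k - 1, b)" using low[OF b] .
        show "(k - 1, b) \<noteq> (k, v)" if "matched k v u" for v u using matchedD(1)[OF that] by (cases k) simp_all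
        show "1 \<le> k" "u \<in> basis D (k - 1)" using matchedD[OF m] by auto
        show "\<not> matched (k - 1) u t" for t
          using matched_top_not_bottom[of "k - 1" u t v] m matchedD(1)[OF m] by auto
      qed (use m in auto)
      then show "- c b * boundary D k (h (k - 1, b) k) u = (if b = u then c b else 0)" by simp
    qed
    also have "\<dots> = c u"
      using m matchedD(2)[OF m] by (subst sum.delta) auto
    finally show ?thesis .
  qed
  show thesis by (rule that[OF chain top bot])
qed

text \<open>
  The same block is injective. Let all tops that lie before the top \<open>x\<close> on a path have coefficient
  zero. In the row of the bottom matched with \<open>x\<close> every other nonzero entry belongs to such a top, so
  the coefficient of \<open>x\<close> vanishes as well. Acyclicity makes this a well-founded induction.
\<close>

lemma top_supported_zero:
  assumes "top_supported k z" "\<And>v u. matched k v u \<Longrightarrow> boundary D k z u = 0"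
  shows "z x = 0"
proof -
  have "wf (E\<^sup>+)" using finite_acyclic_wf[OF finite_E acyclic_E] by (rule wf_trancl)
  then have "\<forall>x. y = (k, x) \<longrightarrow> z x = 0" for y
  proof (induction y)
    case (less y)
    show ?case
    proof (intro allI impI)
      fix x assume y: "y = (k, x)"
      show "z x = 0"
      proof (cases "\<exists>u. matched k x u")
        case False
        then show ?thesis using assms(1) by (auto simp: top_supported_def)
      next
        case True
        then obtain u where m: "matched k x u" by blast
        have other: "bdry D k u v * z v = 0" if v: "v \<in> basis D k" "v \<noteq> x" for v
        proof (cases "bdry D k u v = 0")
          case False
          have "\<not> matched k v u" using m v(2) matched_unique_top by blast
          with False v(1) have "((k, v), (k - 1, u)) \<in> E"
            using matchedD[OF m] by (subst predecessors) simp
          moreover have "((k - 1, u), (k, x)) \<in> E"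
            using m by (simp add: predecessors)
          ultimately have "((k, v), y) \<in> E\<^sup>+" using y by auto
          then show ?thesis using less by auto
        qed simp
        have "0 = (\<Sum>v\<in>basis D k. bdry D k u v * z v)"
          using assms(2)[OF m] matchedD[OF m] by (simp add: boundary_def)
        also have "\<dots> = (\<Sum>v\<in>basis D k. if v = x then bdry D k u v * z v else 0)"
          using other by (intro sum.cong) auto
        also have "\<dots> = bdry D k u x * z x"
          using matchedD(3)[OF m] by simp
        finally show ?thesis using matched_nonzero[OF m] by simp
      qed
    qed
  qed
  then show ?thesis by blast
qed

text \<open>
  For a chain \<open>z\<close> of the reduced complex, this is the only chain of the given complex that agrees with \<open>z\<close> at
  the critical elements, vanishes at the bottoms and whose boundary vanishes at the bottoms of the next lower
  degree.
\<close>

definition lift :: "nat \<Rightarrow> ('i \<Rightarrow> 'a fract) \<Rightarrow> 'i \<Rightarrow> 'a fract"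
  where "lift k z x = (\<Sum>v\<in>basis D' k. z v * h (k, v) k x)"

lemma critical_low: "v \<in> basis D' k \<Longrightarrow> low k (k, v)"
  by (auto simp: low_def basis_reduction)

lemma lift_critical: "x \<in> basis D' k \<Longrightarrow> lift k z x = z x"
proof -
  assume x: "x \<in> basis D' k"
  have "lift k z x = (\<Sum>v\<in>basis D' k. if v = x then z v else 0)"
    unfolding lift_def using h_not_top[OF critical_low, of _ k x] x
    by (intro sum.cong) (auto simp: basis_reduction)
  then show ?thesis using x by simp
qed

lemma lift_not_top: "x \<notin> basis D' k \<Longrightarrow> (\<And>u. \<not> matched k x u) \<Longrightarrow> lift k z x = 0"
  unfolding lift_def by (rule sum.neutral) (auto simp: h_not_top[OF critical_low])

lemma lift_bottom: "matched (Suc k) v u \<Longrightarrow> lift k z u = 0"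
  by (rule lift_not_top) (auto simp: basis_reduction dest: matched_top_not_bottom)

lemma lift_outside: "x \<notin> basis D k \<Longrightarrow> lift k z x = 0"
  by (rule lift_not_top) (auto simp: basis_reduction dest: matchedD(3))

lemma lift_in_chains: "z \<in> chains p D' k \<Longrightarrow> lift k z \<in> chains p D k"
  using lift_outside by (fastforce simp: chains_def lift_def intro!: sum_in_L mult_in_L h_in_L)

lemma lift_scale: "lift k (\<lambda>x. c * z x) x = c * lift k z x"
  by (simp add: lift_def sum_distrib_left mult.assoc)

lemma lift_combination: "lift k (combination J y r) x = combination J (\<lambda>j. lift k (y j)) r x"
proof -
  have "lift k (combination J y r) x = (\<Sum>v\<in>basis D' k. \<Sum>j\<in>J. r j * (y j v * h (k, v) k x))"
    by (simp add: lift_def combination_def sum_distrib_right mult.assoc)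
  also have "\<dots> = (\<Sum>j\<in>J. \<Sum>v\<in>basis D' k. r j * (y j v * h (k, v) k x))"
    by (rule sum.swap)
  finally show ?thesis by (simp add: lift_def combination_def sum_distrib_left)
qed

lemma boundary_lift:
  assumes "1 \<le> k" "u \<in> basis D (k - 1)" "\<And>t. \<not> matched (k - 1) u t"
  shows "boundary D k (lift k z) u = (if \<exists>v. matched k v u then 0 else boundary D' k z u)"
proof -
  have "boundary D k (lift k z) u = (\<Sum>v\<in>basis D' k. z v * boundary D k (h (k, v) k) u)"
    unfolding lift_def by (simp only: boundary_sum boundary_scale)
  also have "\<dots> = (\<Sum>v\<in>basis D' k. z v * (if \<exists>t. matched k t u then 0 else h (k, v) (k - 1) u))"
  proof (rule sum.cong[OF HOL.refl])
    fix v assume v: "v \<in> basis D' k"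
    have "(k, v) \<noteq> (k, t)" if "matched k t x" for t x
      using that v by (auto simp: basis_reduction)
    then have "boundary D k (h (k, v) k) u = (if \<exists>t. matched k t u then 0 else h (k, v) (k - 1) u)"
      using assms by (subst boundary_h[OF critical_low[OF v]]) auto
    then show "z v * boundary D k (h (k, v) k) u
        = z v * (if \<exists>t. matched k t u then 0 else h (k, v) (k - 1) u)" by simp
  qed
  also have "\<dots> = (if \<exists>v. matched k v u then 0 else boundary D' k z u)"
  proof (cases "\<exists>v. matched k v u")
    case False
    then have "u \<in> basis D' (k - 1)" using assms by (auto simp: basis_reduction)
    then show ?thesis using False assms(1)
      by (simp add: boundary_def bdry_reduction mult.commute)
  qed simp
  finally show ?thesis .
qed

lemma boundary_lift_bottom:
  assumes "matched k v u"
  shows "boundary D k (lift k z) u = 0"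
proof -
  have "\<not> matched (k - 1) u t" for t
    using matched_top_not_bottom[of "k - 1" u t v] assms matchedD(1)[OF assms] by auto
  then show ?thesis using matchedD[OF assms] assms by (subst boundary_lift) auto
qed

text \<open>
  The difference of the two sides is supported on tops, because both sides agree at the critical
  elements and vanish at the bottoms. Its boundary vanishes at the bottoms: for a boundary because
  the square of the boundary is zero, for a lifted chain by construction. So it is zero.
\<close>

lemma boundary_lift_commute: "boundary D k (lift k z) x = lift (k - 1) (boundary D' k z) x"
proof (cases "1 \<le> k")
  case False
  then show ?thesis by (simp add: boundary_def lift_def)
next
  case True
  then have k: "Suc (k - 1) = k" by simp
  define a where "a = (\<lambda>x. boundary D k (lift k z) x - lift (k - 1) (boundary D' k z) x)"
  have "top_supported (k - 1) a"
    unfolding top_supported_def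
  proof (intro allI impI)
    fix x assume nt: "\<forall>u. \<not> matched (k - 1) x u"
    show "a x = 0"
    proof (cases "x \<in> basis D (k - 1)")
      case False
      then show ?thesis by (simp add: a_def lift_outside boundary_outside)
    next
      case x: True
      show ?thesis
      proof (cases "\<exists>v. matched k v x")
        case True
        then obtain v where "matched k v x" by blast
        then have "lift (k - 1) (boundary D' k z) x = 0"
          using lift_bottom[of "k - 1" v x] k by simp
        then show ?thesis using x nt \<open>1 \<le> k\<close> True by (simp add: a_def boundary_lift)
      next
        case False
        then have "x \<in> basis D' (k - 1)" using x nt k by (simp add: basis_reduction)
        then show ?thesis using x nt \<open>1 \<le> k\<close> False by (simp add: a_def boundary_lift lift_critical)
      qed
    qed
  qed
  moreover have "boundary D (k - 1) a u = 0" if "matched (k - 1) v u" for v u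
    using boundary_boundary[of "k - 1" "lift k z" u] boundary_lift_bottom[OF that]
    unfolding a_def by (simp only: boundary_diff k) simp
  ultimately have "a x = 0" by (rule top_supported_zero)
  then show ?thesis by (simp add: a_def)
qed

text \<open>
  The square of the reduced boundary vanishes because lifting is an injective chain map into a complex.
\<close>

lemma reduction_local_complex: "local_complex p D'"
proof
  show "finite (basis D' k)" for k by simp
  show "\<exists>N. \<forall>k>N. basis D' k = {}"
    using bounded basis_reduction_subset by (metis subset_empty)
  show "bdry D' k u v \<in> L" for k u v
    by (simp add: bdry_reduction h_in_L)
  show "boundary D' k (boundary D' (Suc k) z) u = 0" for k z u
  proof (cases "u \<in> basis D' (k - 1)")
    case True
    have "boundary D' k (boundary D' (Suc k) z) u = lift (k - 1) (boundary D' k (boundary D' (Suc k) z)) u"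
      using True by (simp add: lift_critical)
    also have "\<dots> = boundary D k (lift k (boundary D' (Suc k) z)) u"
      by (simp add: boundary_lift_commute)
    also have "lift k (boundary D' (Suc k) z) = boundary D (Suc k) (lift (Suc k) z)"
      by (rule ext) (simp add: boundary_lift_commute)
    finally show ?thesis by simp
  qed (simp add: boundary_outside)
qed

lemma card_matching_part: "card (matching_part \<M> k) = card {v. \<exists>u. matched k v u}"
proof -
  have "bij_betw (\<lambda>e. snd (fst e)) (matching_part \<M> k) {v. \<exists>u. matched k v u}"
  proof (rule bij_betwI')
    fix e f assume ef: "e \<in> matching_part \<M> k" "f \<in> matching_part \<M> k"
    show "snd (fst e) = snd (fst f) \<longleftrightarrow> e = f"
    proof
      assume "snd (fst e) = snd (fst f)"
      then have "fst e = fst f" using ef by (auto simp: matching_part_def prod_eq_iff)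
      then show "e = f" using ef matched_disjoint[of e f] by (auto simp: matching_part_def)
    qed simp
  next
    fix e assume "e \<in> matching_part \<M> k"
    moreover obtain k1 v1 l1 u1 where "e = ((k1, v1), (l1, u1))" by (metis prod.collapse)
    ultimately show "snd (fst e) \<in> {v. \<exists>u. matched k v u}"
      using matching_edge[of k1 v1 l1 u1] by (auto simp: matching_part_def)
  next
    fix v assume "v \<in> {v. \<exists>u. matched k v u}"
    then show "\<exists>e\<in>matching_part \<M> k. v = snd (fst e)"
      by (fastforce simp: matching_part_def matched_def)
  qed
  then show ?thesis by (rule bij_betw_same_card)
qed

text \<open>
  The new family consists of the lifted elements of the given one and of the columns of the tops in
  degree \<open>k + 1\<close>, the latter with exponent \<open>0\<close>. The index set \<open>J0\<close> of the latter is arbitrary of the right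
  size, so that the indices of several reductions can be collected in one set.
\<close>

lemma stacked_basis_reduction:
  fixes J J0 :: "'j set"
  assumes st: "stacked_basis p D' k J n y"
    and J0: "finite J0" "J \<inter> J0 = {}" "card J0 = card (matching_part \<M> (Suc k))"
  shows "\<exists>y. stacked_basis p D k (J \<union> J0) (\<lambda>j. if j \<in> J0 then 0 else n j) y"
proof -
  let ?T = "{v. \<exists>u. matched (Suc k) v u}"
  let ?A = "boundary D (Suc k)"
  have fT: "finite ?T"
    by (rule finite_subset[OF _ finite_basis[of "Suc k"]]) (use matchedD(3) in blast)
  obtain \<beta> where \<beta>: "bij_betw \<beta> J0 ?T"
    using finite_same_card_bij[OF J0(1) fT] J0(3) by (auto simp: card_matching_part)
  have finJ: "finite J" and yc: "\<And>j. j \<in> J \<Longrightarrow> y j \<in> chains p D' k"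
    and indep: "\<And>r j. combination J y r = (\<lambda>x. 0) \<Longrightarrow> j \<in> J \<Longrightarrow> r j = 0"
    and sat: "\<And>z r. z \<in> chains p D' k \<Longrightarrow> range r \<subseteq> L \<Longrightarrow> (\<lambda>x. \<pi> * z x) = combination J y r \<Longrightarrow>
       \<exists>r. range r \<subseteq> L \<and> z = combination J y r"
    and im: "boundary D' (Suc k) ` chains p D' (Suc k) =
      {combination J y (\<lambda>j. r j * \<pi> ^ n j) |r. range r \<subseteq> L}"
    using st unfolding stacked_basis_def by blast+
  define \<tau> where "\<tau> r x = (\<Sum>j\<in>J0. if x = \<beta> j then r j else 0)" for r :: "'j \<Rightarrow> 'a fract" and x
  define Y where "Y j = (if j \<in> J0 then ?A (\<lambda>x. if x = \<beta> j then 1 else 0) else lift k (y j))" for j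
  let ?n = "\<lambda>j. if j \<in> J0 then 0 else n j"

  \<comment> \<open>The chain \<open>\<tau> r\<close> has the coefficients \<open>r\<close> at the tops;
      every chain supported on tops is of this form.\<close>
  have tau_beta: "\<tau> r (\<beta> j) = r j" if "j \<in> J0" for r j
  proof -
    have "\<tau> r (\<beta> j) = (\<Sum>i\<in>J0. if i = j then r i else 0)"
      unfolding \<tau>_def using \<beta> that by (intro sum.cong) (auto simp: bij_betw_def inj_on_def)
    then show ?thesis using that J0(1) by simp
  qed
  have tau_top: "top_supported (Suc k) (\<tau> r)" for r
  proof -
    have "\<tau> r x = 0" if "\<forall>u. \<not> matched (Suc k) x u" for x
    proof -
      have "x \<noteq> \<beta> j" if "j \<in> J0" for j
        using bij_betw_apply[OF \<beta> that] \<open>\<forall>u. \<not> matched (Suc k) x u\<close> by blast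
      then show ?thesis by (simp add: \<tau>_def)
    qed
    then show ?thesis by (simp add: top_supported_def)
  qed
  have tau_chain: "\<tau> r \<in> chains p D (Suc k)" if "range r \<subseteq> L" for r
  proof -
    have "\<tau> r x \<in> L" for x unfolding \<tau>_def by (rule sum_in_L) (use that in auto)
    moreover have "\<tau> r x = 0" if "x \<notin> basis D (Suc k)" for x
      using tau_top[of r] that matchedD(3) unfolding top_supported_def by blast
    ultimately show ?thesis by (simp add: chains_def)
  qed
  have top_tau: "\<exists>r. range r \<subseteq> L \<and> z = \<tau> r"
    if "top_supported (Suc k) z" "\<And>x. z x \<in> L" for z
  proof (intro exI conjI ext)
    show "range (\<lambda>j. z (\<beta> j)) \<subseteq> L" using that by auto
    fix x show "z x = \<tau> (\<lambda>j. z (\<beta> j)) x"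
    proof (cases "x \<in> ?T")
      case True
      then obtain j where "j \<in> J0" "x = \<beta> j" using \<beta> by (auto simp: bij_betw_def)
      then show ?thesis by (simp add: tau_beta)
    next
      case False
      then show ?thesis using that(1) tau_top[of "\<lambda>j. z (\<beta> j)"] by (auto simp: top_supported_def)
    qed
  qed
  have Y_comb: "combination (J \<union> J0) Y r x = ?A (\<tau> r) x + lift k (combination J y r) x" for r x
  proof -
    have "combination (J \<union> J0) Y r x = (\<Sum>j\<in>J. r j * Y j x) + (\<Sum>j\<in>J0. r j * Y j x)"
      unfolding combination_def by (rule sum.union_disjoint) (use finJ J0 in auto)
    also have "(\<Sum>j\<in>J. r j * Y j x) = lift k (combination J y r) x"
      unfolding lift_combination combination_def using J0(2) by (intro sum.cong) (auto simp: Y_def)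
    also have "(\<Sum>j\<in>J0. r j * Y j x) = (\<Sum>j\<in>J0. ?A (\<lambda>x. r j * (if x = \<beta> j then 1 else 0)) x)"
      by (rule sum.cong) (auto simp: Y_def boundary_scale)
    also have "\<dots> = ?A (\<lambda>x. \<Sum>j\<in>J0. r j * (if x = \<beta> j then 1 else 0)) x"
      by (simp add: boundary_sum)
    also have "(\<lambda>x. \<Sum>j\<in>J0. r j * (if x = \<beta> j then 1 else 0)) = \<tau> r"
      by (auto simp: \<tau>_def fun_eq_iff intro!: sum.cong)
    finally show ?thesis by (simp add: add.commute)
  qed
  have y_outside: "combination J y r x = 0" if "x \<notin> basis D' k" for r x
    using yc that by (auto simp: combination_def chains_def intro!: sum.neutral)
  have Y_bottom: "combination (J \<union> J0) Y r u = ?A (\<tau> r) u" if "matched (Suc k) v u" for r v u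
    using lift_bottom[OF that] by (simp add: Y_comb)

  \<comment> \<open>At the bottoms only the columns of the tops are visible, so their coefficients vanish
      first.\<close>
  have Y_indep: "combination (J \<union> J0) Y r = (\<lambda>x. 0) \<Longrightarrow> j \<in> J \<union> J0 \<Longrightarrow> r j = 0" for r j
  proof -
    assume r: "combination (J \<union> J0) Y r = (\<lambda>x. 0)" and j: "j \<in> J \<union> J0"
    have "\<tau> r x = 0" for x
      using tau_top by (rule top_supported_zero) (metis Y_bottom r)
    then have tau0: "\<tau> r = (\<lambda>x. 0)" by auto
    then have "lift k (combination J y r) x = 0" for x
      using fun_cong[OF r, of x] by (simp add: Y_comb)
    then have "combination J y r x = 0" for x
      using lift_critical[of x k "combination J y r"] y_outside[of x r] by (cases "x \<in> basis D' k") auto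
    then have "combination J y r = (\<lambda>x. 0)" by auto
    then show "r j = 0"
      using j indep tau_beta[of j r] tau0 by auto
  qed
  \<comment> \<open>A chain \<open>z\<close> is cleared at the bottoms by the image of some \<open>t\<close>
      supported on tops. What remains is lifted from its critical part, where saturation is
      known.\<close>
  have Y_sat: "\<exists>r. range r \<subseteq> L \<and> z = combination (J \<union> J0) Y r"
    if z: "z \<in> chains p D k" and r: "range r \<subseteq> L" "(\<lambda>x. \<pi> * z x) = combination (J \<union> J0) Y r" for z r
  proof -
    have zL: "z x \<in> L" for x using z by (simp add: chains_def)
    obtain t where t: "t \<in> chains p D (Suc k)" "top_supported (Suc k) t"
      "\<And>v u. matched (Suc k) v u \<Longrightarrow> ?A t u = z u"
      by (rule bottoms_solvable[of z "Suc k", OF zL]) blast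
    have "\<pi> * t x - \<tau> r x = 0" for x
    proof (rule top_supported_zero)
      show "top_supported (Suc k) (\<lambda>x. \<pi> * t x - \<tau> r x)"
        using t(2) tau_top[of r] by (simp add: top_supported_def)
      show "?A (\<lambda>x. \<pi> * t x - \<tau> r x) u = 0" if m: "matched (Suc k) v u" for v u
        using fun_cong[OF r(2), of u] by (simp add: boundary_diff boundary_scale t(3)[OF m] Y_bottom[OF m])
    qed
    then have tau: "\<tau> r = (\<lambda>x. \<pi> * t x)" by (auto simp: fun_eq_iff)
    define z1 where "z1 x = (if x \<in> basis D' k then z x - ?A t x else 0)" for x
    have lz: "\<pi> * (z x - ?A t x) = lift k (combination J y r) x" for x
      using fun_cong[OF r(2), of x] by (simp add: Y_comb tau boundary_scale algebra_simps)
    have z1: "(\<lambda>x. \<pi> * z1 x) = combination J y r"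
      using lz lift_critical[of _ k "combination J y r"] by (auto simp: z1_def y_outside)
    moreover have "z1 \<in> chains p D' k"
      using z boundary_in_chains[OF t(1)] by (auto simp: chains_def z1_def)
    ultimately obtain s where s: "range s \<subseteq> L" "z1 = combination J y s"
      using sat[of z1 r] r(1) by blast
    have zx: "z x = ?A t x + lift k z1 x" for x
    proof -
      have "\<pi> * (z x - ?A t x) = \<pi> * lift k z1 x"
        by (simp add: lz z1[symmetric] lift_scale)
      then have "z x - ?A t x = lift k z1 x" by simp
      then show ?thesis by (simp add: algebra_simps)
    qed
    obtain q where q: "range q \<subseteq> L" "t = \<tau> q"
      using top_tau[OF t(2)] t(1) by (auto simp: chains_def)
    let ?r = "\<lambda>j. if j \<in> J0 then q j else s j"
    have "\<tau> ?r = \<tau> q" by (auto simp: \<tau>_def fun_eq_iff intro!: sum.cong)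
    moreover have "combination J y ?r = combination J y s"
      using J0(2) by (intro combination_cong) auto
    ultimately have "z = combination (J \<union> J0) Y ?r"
      using zx by (auto simp: Y_comb q(2) s(2))
    moreover have "range ?r \<subseteq> L" using q(1) s(1) by auto
    ultimately show ?thesis by blast
  qed
  \<comment> \<open>With exponent zero on \<open>J0\<close>, the multiples split into the same two parts as
      the family.\<close>
  have Y_image: "?A ` chains p D (Suc k) =
      {combination (J \<union> J0) Y (\<lambda>j. r j * \<pi> ^ ?n j) |r. range r \<subseteq> L}" (is "?l = ?r")
  proof -
    have eq: "combination (J \<union> J0) Y (\<lambda>j. r j * \<pi> ^ ?n j) x
        = ?A (\<tau> r) x + lift k (combination J y (\<lambda>j. r j * \<pi> ^ n j)) x" for r x
    proof -
      have "\<tau> (\<lambda>j. r j * \<pi> ^ ?n j) = \<tau> r" by (auto simp: \<tau>_def fun_eq_iff intro!: sum.cong)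
      moreover have "combination J y (\<lambda>j. r j * \<pi> ^ ?n j) = combination J y (\<lambda>j. r j * \<pi> ^ n j)"
        using J0(2) by (intro combination_cong) auto
      ultimately show ?thesis by (simp only: Y_comb)
    qed
    show ?thesis
    proof
      show "?l \<subseteq> ?r"
      proof
        fix b assume "b \<in> ?l"
        then obtain z where z: "z \<in> chains p D (Suc k)" "b = ?A z" by blast
        \<comment> \<open>Adding a boundary clears the bottoms in degree \<open>k + 1\<close> without changing the
            boundary of \<open>z\<close>. The resulting \<open>z1\<close> is the sum of the lift of
            its critical part \<open>c\<close> and a chain \<open>q\<close> supported on tops.\<close>
        have zL: "z x \<in> L" for x using z(1) by (simp add: chains_def)
        obtain t where t: "t \<in> chains p D (Suc (Suc k))"
          "\<And>v u. matched (Suc (Suc k)) v u \<Longrightarrow> boundary D (Suc (Suc k)) t u = z u"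
          by (rule bottoms_solvable[of z "Suc (Suc k)", OF zL]) blast
        define z1 where "z1 x = z x - boundary D (Suc (Suc k)) t x" for x
        define c where "c x = (if x \<in> basis D' (Suc k) then z1 x else 0)" for x
        have z1: "z1 \<in> chains p D (Suc k)"
          using z(1) boundary_in_chains[OF t(1)] by (simp add: chains_def z1_def diff_in_L)
        have c: "c \<in> chains p D' (Suc k)"
          using z1 by (simp add: chains_def c_def)
        define q where "q x = z1 x - lift (Suc k) c x" for x
        have "top_supported (Suc k) q"
          unfolding top_supported_def
        proof (intro allI impI)
          fix x assume nt: "\<forall>u. \<not> matched (Suc k) x u"
          show "q x = 0"
          proof (cases "x \<in> basis D' (Suc k)")
            case True
            then show ?thesis by (simp add: q_def lift_critical c_def)
          next
            case False
            have "z1 x = 0"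
            proof (cases "x \<in> basis D (Suc k)")
              case True
              with False nt obtain v where "matched (Suc (Suc k)) v x" by (auto simp: basis_reduction)
              then show ?thesis using t(2) by (simp add: z1_def)
            next
              case False
              then show ?thesis using z1 by (simp add: chains_def)
            qed
            then show ?thesis using False nt by (simp add: q_def lift_not_top)
          qed
        qed
        moreover have "q x \<in> L" for x
          using z1 lift_in_chains[OF c] by (simp add: chains_def q_def diff_in_L)
        ultimately obtain r where r: "range r \<subseteq> L" "q = \<tau> r" using top_tau[of q] by blast
        have "boundary D' (Suc k) c \<in> boundary D' (Suc k) ` chains p D' (Suc k)"
          using c by blast
        then obtain s where s: "range s \<subseteq> L"
          "boundary D' (Suc k) c = combination J y (\<lambda>j. s j * \<pi> ^ n j)"
          unfolding im by auto
        let ?s = "\<lambda>j. if j \<in> J0 then r j else s j"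
        have "b x = combination (J \<union> J0) Y (\<lambda>j. ?s j * \<pi> ^ ?n j) x" for x
        proof -
          have "b x = ?A z1 x" unfolding z1_def[abs_def] by (simp add: z(2) boundary_diff)
          also have "\<dots> = ?A (\<lambda>x. q x + lift (Suc k) c x) x" by (simp add: q_def)
          also have "\<dots> = ?A q x + ?A (lift (Suc k) c) x" by (rule boundary_add)
          also have "\<dots> = ?A q x + lift k (boundary D' (Suc k) c) x"
            by (simp add: boundary_lift_commute)
          also have "boundary D' (Suc k) c = combination J y (\<lambda>j. ?s j * \<pi> ^ n j)"
            unfolding s(2) using J0(2) by (intro combination_cong) auto
          also have "q = \<tau> ?s" unfolding r(2) by (auto simp: \<tau>_def fun_eq_iff intro!: sum.cong)
          finally show ?thesis by (simp only: eq)
        qed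
        then have "b = combination (J \<union> J0) Y (\<lambda>j. ?s j * \<pi> ^ ?n j)" by (rule ext)
        moreover have "range ?s \<subseteq> L" using r(1) s(1) by auto
        ultimately show "b \<in> ?r" by (intro CollectI exI[of _ ?s] conjI)
      qed
      show "?r \<subseteq> ?l"
      proof
        fix b assume "b \<in> ?r"
        then obtain r where r: "range r \<subseteq> L" "b = combination (J \<union> J0) Y (\<lambda>j. r j * \<pi> ^ ?n j)"
          by blast
        have "combination J y (\<lambda>j. r j * \<pi> ^ n j) \<in> boundary D' (Suc k) ` chains p D' (Suc k)"
          unfolding im by (intro CollectI exI[of _ r] conjI HOL.refl r(1))
        then obtain c where c: "c \<in> chains p D' (Suc k)"
          "combination J y (\<lambda>j. r j * \<pi> ^ n j) = boundary D' (Suc k) c" by blast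
        have "b = ?A (\<lambda>x. \<tau> r x + lift (Suc k) c x)"
          by (rule ext) (simp add: r(2) eq c(2) boundary_add boundary_lift_commute)
        moreover have "(\<lambda>x. \<tau> r x + lift (Suc k) c x) \<in> chains p D (Suc k)"
          using tau_chain[OF r(1)] lift_in_chains[OF c(1)] by (auto simp: chains_def)
        ultimately show "b \<in> ?l" by blast
      qed
    qed
  qed
  have Y_chains: "Y j \<in> chains p D k" if "j \<in> J \<union> J0" for j
  proof (cases "j \<in> J0")
    case True
    then have "\<beta> j \<in> basis D (Suc k)" using bij_betw_apply[OF \<beta>, of j] matchedD(3) by blast
    then have "(\<lambda>x. if x = \<beta> j then 1 else 0) \<in> chains p D (Suc k)" by (auto simp: chains_def)
    from boundary_in_chains[OF this] show ?thesis using True by (simp add: Y_def)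
  next
    case False
    then show ?thesis using that yc lift_in_chains by (auto simp: Y_def)
  qed
  have "stacked_basis p D k (J \<union> J0) ?n Y"
    unfolding stacked_basis_def
  proof (intro conjI ballI allI impI)
    show "finite (J \<union> J0)" using finJ J0(1) by simp
    show "\<exists>r. range r \<subseteq> L \<and> z = combination (J \<union> J0) Y r"
      if "z \<in> chains p D k" "\<exists>r. range r \<subseteq> L \<and> (\<lambda>x. \<pi> * z x) = combination (J \<union> J0) Y r" for z
      using that Y_sat by blast
  qed (fact Y_chains Y_indep Y_image)+
  then show ?thesis by (intro exI[of _ Y])
qed

end

section \<open>The procedure\<close>

context localization_at_prime
begin

lemma repeated_reduction_local_complex:
  assumes "repeated_reduction p D m E" "local_complex p D"
  shows "local_complex p E"
  using assms
proof induction
  case (step D \<M> m E)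
  interpret local_complex p D by fact
  interpret matched_complex p D \<M> by unfold_locales fact
  show ?case using step reduction_local_complex by blast
qed

text \<open>
  Induction over the reductions: each of them takes as many indices from \<open>J0\<close> as its matching has edges
  in degree \<open>k + 1\<close>.
\<close>

lemma stacked_basis_repeated_reduction:
  fixes J J0 :: "'j set"
  assumes "repeated_reduction p D m E" "local_complex p D"
    and "stacked_basis p E k J n y" "finite J0" "J \<inter> J0 = {}" "card J0 = m (Suc k)"
  shows "\<exists>y. stacked_basis p D k (J \<union> J0) (\<lambda>j. if j \<in> J0 then 0 else n j) y"
  using assms
proof (induction arbitrary: J0)
  case (refl D)
  then have "J0 = {}" by simp
  with refl show ?case by auto
next
  case (step D \<M> m E)
  interpret local_complex p D by fact
  interpret matched_complex p D \<M> by unfold_locales fact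
  have "m (Suc k) \<le> card J0" using step.prems(5) by simp
  then obtain J1 where J1: "J1 \<subseteq> J0" "card J1 = m (Suc k)"
    by (meson obtain_subset_with_card_n)
  have fin: "finite J1" using J1(1) step.prems(3) by (rule finite_subset)
  have "J \<inter> J1 = {}" using J1(1) step.prems(4) by blast
  from step.IH[OF reduction_local_complex step.prems(2) fin this J1(2)]
  obtain y' where y': "stacked_basis p D' k (J \<union> J1) (\<lambda>j. if j \<in> J1 then 0 else n j) y'" ..
  have "finite (J0 - J1)" "(J \<union> J1) \<inter> (J0 - J1) = {}" using step.prems(3,4) by auto
  moreover have "card (J0 - J1) = card (matching_part \<M> (Suc k))"
    using J1 fin step.prems(5) by (simp add: card_Diff_subset)
  ultimately have "\<exists>y. stacked_basis p D k (J \<union> J1 \<union> (J0 - J1))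
      (\<lambda>j. if j \<in> J0 - J1 then 0 else if j \<in> J1 then 0 else n j) y"
    by (rule stacked_basis_reduction[OF y'])
  moreover have "J \<union> J1 \<union> (J0 - J1) = J \<union> J0" using J1(1) by blast
  moreover have "(\<lambda>j. if j \<in> J0 - J1 then 0 else if j \<in> J1 then 0 else n j) = (\<lambda>j. if j \<in> J0 then 0 else n j)"
    using J1(1) by (intro ext) auto
  ultimately show ?case by (simp only:)
qed

lemma chains_divide [simp]: "chains p (divide_boundaries D c) k = chains p D k"
  by (simp add: chains_def divide_boundaries_def)

lemma boundary_divide: "boundary (divide_boundaries D c) k z u = boundary D k z u / c"
  by (simp add: boundary_def divide_boundaries_def sum_divide_distrib)

lemma stacked_basis_scale:
  assumes "stacked_basis p (divide_boundaries D (\<pi> ^ a)) k J n y"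
  shows "stacked_basis p D k J (\<lambda>j. a + n j) y"
proof -
  let ?D = "divide_boundaries D (\<pi> ^ a)"
  have "boundary D (Suc k) z = (\<lambda>x. \<pi> ^ a * boundary ?D (Suc k) z x)" for z
    by (simp add: boundary_divide)
  then have "boundary D (Suc k) ` chains p D (Suc k)
      = (\<lambda>b x. \<pi> ^ a * b x) ` boundary ?D (Suc k) ` chains p ?D (Suc k)"
    unfolding chains_divide image_image by (rule image_cong[OF HOL.refl])
  also have "\<dots> = (\<lambda>b x. \<pi> ^ a * b x) ` {combination J y (\<lambda>j. r j * \<pi> ^ n j) |r. range r \<subseteq> L}"
    using assms unfolding stacked_basis_def by blast
  also have "\<dots> = {combination J y (\<lambda>j. r j * \<pi> ^ (a + n j)) |r. range r \<subseteq> L}"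
  proof -
    have "\<pi> ^ a * combination J y (\<lambda>j. r j * \<pi> ^ n j) x
        = combination J y (\<lambda>j. r j * \<pi> ^ (a + n j)) x" for r x
      by (simp add: combination_def sum_distrib_left power_add mult_ac)
    then show ?thesis by (simp only: setcompr_eq_image image_image)
  qed
  finally show ?thesis using assms unfolding stacked_basis_def chains_divide by blast
qed

lemma stacked_basis_zero:
  assumes "local_complex p D" "zero_boundaries D"
  shows "stacked_basis p D k {} n y"
proof -
  have "bdry D (Suc k) u v = 0" if "u \<in> basis D k" "v \<in> basis D (Suc k)" for u v
  proof -
    have "bdry D (Suc k) u v \<in> entries D"
      unfolding entries_def using that by (intro CollectI exI[of _ "Suc k"] exI[of _ u] exI[of _ v]) simp
    then show ?thesis using assms(2) by (simp add: zero_boundaries_def)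
  qed
  then have "boundary D (Suc k) z = (\<lambda>x. 0)" for z
    by (auto simp: boundary_def fun_eq_iff intro!: sum.neutral)
  moreover have "(\<lambda>x. 0) \<in> chains p D (Suc k)" by (simp add: chains_def)
  ultimately have "boundary D (Suc k) ` chains p D (Suc k) = {\<lambda>x. 0}" by auto
  moreover have comb: "combination {} y r = (\<lambda>x. 0)" for r
    by (simp add: combination_def fun_eq_iff)
  moreover have zero: "range (\<lambda>_. 0) \<subseteq> L" by auto
  ultimately have "boundary D (Suc k) ` chains p D (Suc k) =
      {combination {} y (\<lambda>j. r j * \<pi> ^ n j) |r. range r \<subseteq> L}" by auto
  moreover have "\<exists>r. range r \<subseteq> L \<and> z = combination {} y r"
    if "(\<lambda>x. \<pi> * z x) = combination {} y r" for z r
  proof -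
    have "z = (\<lambda>x. 0)" using that unfolding comb by (simp add: fun_eq_iff)
    then show ?thesis using zero comb by (intro exI[of _ "\<lambda>_. 0"]) simp
  qed
  ultimately show ?thesis unfolding stacked_basis_def by auto
qed

lemma divide_local_complex:
  assumes "local_complex p D" "\<forall>x \<in> entries D - {0}. localization_dvd p (\<pi> ^ a) x"
  shows "local_complex p (divide_boundaries D (\<pi> ^ a))"
proof -
  interpret local_complex p D by fact
  show ?thesis
  proof
    show "finite (basis (divide_boundaries D (\<pi> ^ a)) k)" for k by (simp add: divide_boundaries_def)
    show "\<exists>N. \<forall>k>N. basis (divide_boundaries D (\<pi> ^ a)) k = {}"
      using bounded by (simp add: divide_boundaries_def)
    fix k u v
    assume "1 \<le> k" "u \<in> basis (divide_boundaries D (\<pi> ^ a)) (k - 1)" "v \<in> basis (divide_boundaries D (\<pi> ^ a)) k"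
    then have "bdry D k u v \<in> entries D" by (auto simp: entries_def divide_boundaries_def)
    then consider "bdry D k u v = 0" | z where "z \<in> L" "bdry D k u v = \<pi> ^ a * z"
      using assms(2) unfolding localization_dvd_def by blast
    then show "bdry (divide_boundaries D (\<pi> ^ a)) k u v \<in> L"
      by cases (simp_all add: divide_boundaries_def)
  next
    fix k z u
    have "boundary (divide_boundaries D (\<pi> ^ a)) (Suc k) z = (\<lambda>x. (1 / \<pi> ^ a) * boundary D (Suc k) z x)"
      by (simp add: fun_eq_iff boundary_divide)
    then show "boundary (divide_boundaries D (\<pi> ^ a)) k (boundary (divide_boundaries D (\<pi> ^ a)) (Suc k) z) u = 0"
      by (simp only: boundary_divide boundary_scale boundary_boundary) simp
  qed
qed

text \<open>
  Otherwise all entries of the divided complex would be multiples of \<open>p\<close>, and a higher power of \<open>p\<close>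
  would divide the original ones.
\<close>

lemma divide_has_unit_entry:
  assumes "local_complex p D" "\<not> zero_boundaries D" "largest_exponent p D a"
  shows "has_unit_entry p (divide_boundaries D (\<pi> ^ a))"
proof (rule ccontr)
  assume nu: "\<not> ?thesis"
  have "localization_dvd p (\<pi> ^ Suc a) x" if x: "x \<in> entries D - {0}" for x
  proof -
    obtain z where z: "z \<in> L" "x = \<pi> ^ a * z"
      using assms(3) x by (auto simp: largest_exponent_def localization_dvd_def)
    have "x / \<pi> ^ a \<in> entries (divide_boundaries D (\<pi> ^ a))"
      using x by (auto simp: entries_def divide_boundaries_def)
    then have "\<not> localization_unit p z" using nu z by (auto simp: has_unit_entry_def)
    then obtain y where "y \<in> L" "z = \<pi> * y" using nonunit_is_multiple[OF z(1)] by blast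
    then show ?thesis using z by (auto simp: localization_dvd_def mult_ac)
  qed
  then have "Suc a \<le> a" using assms(3) unfolding largest_exponent_def by blast
  then show False by simp
qed

definition total_rank :: "('i, 'f) based_complex \<Rightarrow> nat"
  where "total_rank D = card (SIGMA k:UNIV. basis D k)"

lemma finite_total_basis:
  assumes "local_complex p D"
  shows "finite (SIGMA k:UNIV. basis D k)"
proof -
  interpret local_complex p D by fact
  obtain N where N: "\<And>k. k > N \<Longrightarrow> basis D k = {}" using bounded by blast
  then have "k \<le> N" if "v \<in> basis D k" for k v using that by (cases "k \<le> N") auto
  then have "(SIGMA k:UNIV. basis D k) = (SIGMA k:{..N}. basis D k)" by auto
  then show ?thesis by (simp add: finite_SigmaI)
qed

lemma repeated_reduction_total_rank:
  assumes "repeated_reduction p D m E" "local_complex p D"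
  shows "total_rank E \<le> total_rank D \<and> (E \<noteq> D \<longrightarrow> total_rank E < total_rank D)"
  using assms
proof induction
  case (step D \<M> m E)
  interpret local_complex p D by fact
  interpret matched_complex p D \<M> by unfold_locales fact
  obtain e where "e \<in> \<M>" using step.hyps(2) by blast
  moreover obtain k v l u where "e = ((k, v), (l, u))" by (metis prod.collapse)
  ultimately have "matched k v u" using matching_edge by blast
  then have "v \<in> basis D k" "v \<notin> basis D' k" using matchedD by (auto simp: basis_reduction)
  then have "(SIGMA k:UNIV. basis D' k) \<subset> (SIGMA k:UNIV. basis D k)"
    using basis_reduction_subset by blast
  then have "total_rank D' < total_rank D"
    unfolding total_rank_def using finite_total_basis[OF step.prems] by (rule psubset_card_mono[rotated])
  then show ?case using step.IH reduction_local_complex by auto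
qed simp

lemma stacked_basis_cong:
  assumes "stacked_basis p D k J n y" "\<And>j. j \<in> J \<Longrightarrow> n j = n' j"
  shows "stacked_basis p D k J n' y"
proof -
  have "combination J y (\<lambda>j. r j * \<pi> ^ n' j) = combination J y (\<lambda>j. r j * \<pi> ^ n j)" for r
    by (rule combination_cong) (simp add: assms(2))
  then show ?thesis using assms(1) unfolding stacked_basis_def by simp
qed

end

locale procedure = localization_at_prime p for p :: "'a::idom" +
  fixes D0 :: "('i, 'a fract) based_complex" and D E m a
  assumes run: "procedure_run p D0 D E m a"
    and initial: "local_complex p D0"
begin

lemma run_step:
  assumes "\<forall>j<i. \<not> zero_boundaries (E j)"
  shows "repeated_reduction p (D i) (\<lambda>k. m k i) (E i)" "\<not> has_unit_entry p (E i)"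
    "zero_boundaries (E i) \<Longrightarrow> D (Suc i) = E i"
    "\<not> zero_boundaries (E i) \<Longrightarrow> largest_exponent p (E i) (a (Suc i))"
    "\<not> zero_boundaries (E i) \<Longrightarrow> D (Suc i) = divide_boundaries (E i) (\<pi> ^ a (Suc i))"
  using run assms unfolding procedure_run_def by metis+

lemma run_local_complex:
  assumes "\<forall>j<i. \<not> zero_boundaries (E j)"
  shows "local_complex p (D i)" "local_complex p (E i)"
proof -
  have "local_complex p (D i)"
    using assms
  proof (induction i)
    case 0
    then show ?case using run initial by (simp add: procedure_run_def)
  next
    case (Suc i)
    then have i: "\<forall>j<i. \<not> zero_boundaries (E j)" "\<not> zero_boundaries (E i)" by auto
    have "local_complex p (E i)"
      using repeated_reduction_local_complex[OF run_step(1)[OF i(1)] Suc.IH[OF i(1)]] .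
    then show ?case
      unfolding run_step(5)[OF i] using run_step(4)[OF i]
      by (intro divide_local_complex) (auto simp: largest_exponent_def)
  qed
  then show "local_complex p (D i)" "local_complex p (E i)"
    using repeated_reduction_local_complex[OF run_step(1)[OF assms]] by auto
qed

text \<open>
  From the second complex on, every complex of the sequence has a unit entry, so at least one nonempty
  matching is used in the passage to the next one and the total rank drops.
\<close>

lemma procedure_stops: "\<exists>i. zero_boundaries (E i) \<and> (\<forall>j<i. \<not> zero_boundaries (E j))"
proof -
  have "\<exists>i. zero_boundaries (E i)"
  proof (rule ccontr)
    assume "\<not> ?thesis"
    then have nz: "\<not> zero_boundaries (E i)" for i by blast
    then have active: "\<forall>j<i. \<not> zero_boundaries (E j)" for i by blast
    have "total_rank (D (Suc (Suc i))) < total_rank (D (Suc i))" for i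
    proof -
      have "has_unit_entry p (D (Suc i))"
        unfolding run_step(5)[OF active nz]
        by (rule divide_has_unit_entry[OF run_local_complex(2)[OF active] nz run_step(4)[OF active nz]])
      then have "E (Suc i) \<noteq> D (Suc i)" using run_step(2)[OF active, of "Suc i"] by auto
      then have "total_rank (E (Suc i)) < total_rank (D (Suc i))"
        using repeated_reduction_total_rank[OF run_step(1) run_local_complex(1), OF active active, of "Suc i"]
        by blast
      moreover have "total_rank (D (Suc (Suc i))) = total_rank (E (Suc i))"
        unfolding run_step(5)[OF active nz] by (simp add: total_rank_def divide_boundaries_def)
      ultimately show ?thesis by simp
    qed
    then have "total_rank (D (Suc i)) + i \<le> total_rank (D (Suc 0))" for i
    proof (induction i)
      case (Suc i)
      from Suc.prems[of i] Suc.IH[OF Suc.prems] show ?case by simp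
    qed simp
    from this[of "Suc (total_rank (D (Suc 0)))"] show False by simp
  qed
  then obtain i where i: "zero_boundaries (E i)" by blast
  show ?thesis
    by (rule exI[of _ "LEAST i. zero_boundaries (E i)"])
      (use LeastI[of "\<lambda>i. zero_boundaries (E i)", OF i] not_less_Least in blast)
qed

text \<open>
  The index set collects the edges in degree \<open>k + 1\<close> used from the \<open>i\<close>-th complex on. An edge used in
  the passage from the \<open>i'\<close>-th complex has gone through the divisions number \<open>i + 1\<close> to \<open>i'\<close>.
\<close>

lemma stacked_basis_run:
  assumes last: "zero_boundaries (E t)" "\<forall>j<t. \<not> zero_boundaries (E j)" and "i \<le> t"
  shows "\<exists>y. stacked_basis p (D i) k {(i', j). i \<le> i' \<and> i' \<le> t \<and> j < m (Suc k) i'}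
    (\<lambda>(i', j). \<Sum>l = Suc i..i'. a l) y"
  using \<open>i \<le> t\<close>
proof (induction rule: inc_induct)
  case base
  have "stacked_basis p (E t) k {} (\<lambda>_. 0) (\<lambda>_ _. 0)"
    by (rule stacked_basis_zero[OF run_local_complex(2)[OF last(2)] last(1)])
  from stacked_basis_repeated_reduction[OF run_step(1)[OF last(2)] run_local_complex(1)[OF last(2)] this,
      of "{t} \<times> {..<m (Suc k) t}"]
  obtain y where "stacked_basis p (D t) k ({} \<union> {t} \<times> {..<m (Suc k) t})
      (\<lambda>j. if j \<in> {t} \<times> {..<m (Suc k) t} then 0 else 0) y" by auto
  moreover have "{} \<union> {t} \<times> {..<m (Suc k) t} = {(i', j). t \<le> i' \<and> i' \<le> t \<and> j < m (Suc k) i'}"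
    by auto
  ultimately have "stacked_basis p (D t) k {(i', j). t \<le> i' \<and> i' \<le> t \<and> j < m (Suc k) i'}
      (\<lambda>j. if j \<in> {t} \<times> {..<m (Suc k) t} then 0 else 0) y" by (simp only:)
  from stacked_basis_cong[OF this, of "\<lambda>(i', j). \<Sum>l = Suc t..i'. a l"] show ?case by auto
next
  case (step i)
  let ?J = "{(i', j). Suc i \<le> i' \<and> i' \<le> t \<and> j < m (Suc k) i'}" and ?S = "{i} \<times> {..<m (Suc k) i}"
  from step.hyps last(2) have active: "\<forall>j<i. \<not> zero_boundaries (E j)" "\<not> zero_boundaries (E i)" by auto
  obtain y where "stacked_basis p (D (Suc i)) k ?J (\<lambda>(i', j). \<Sum>l = Suc (Suc i)..i'. a l) y"
    using step.IH ..
  then have "stacked_basis p (E i) k ?J (\<lambda>j. a (Suc i) + (case j of (i', j) \<Rightarrow> \<Sum>l = Suc (Suc i)..i'. a l)) y"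
    unfolding run_step(5)[OF active] by (rule stacked_basis_scale)
  note reduction = stacked_basis_repeated_reduction[OF run_step(1)[OF active(1)]
      run_local_complex(1)[OF active(1)] this, of ?S]
  have "finite ?S" "?J \<inter> ?S = {}" "card ?S = m (Suc k) i" by auto
  from reduction[OF this] obtain y where y: "stacked_basis p (D i) k (?J \<union> ?S)
      (\<lambda>j. if j \<in> ?S then 0
        else a (Suc i) + (case j of (i', j) \<Rightarrow> \<Sum>l = Suc (Suc i)..i'. a l)) y" ..
  have "stacked_basis p (D i) k (?J \<union> ?S) (\<lambda>(i', j). \<Sum>l = Suc i..i'. a l) y"
    by (rule stacked_basis_cong[OF y]) (auto simp: sum.atLeast_Suc_atMost[of "Suc i"])
  moreover have "?J \<union> ?S = {(i', j). i \<le> i' \<and> i' \<le> t \<and> j < m (Suc k) i'}"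
    using step.hyps by (auto simp: le_less Suc_le_eq)
  ultimately show ?case by (auto simp only:)
qed

end

section \<open>Principal ideal domains as type class and as record\<close>

lemma ring_of_type_algebra_simps [simp]:
  "carrier (ring_of_type_algebra :: 'a::comm_ring_1 ring) = UNIV"
  "x \<otimes>\<^bsub>(ring_of_type_algebra :: 'a ring)\<^esub> y = x * y"
  "x \<oplus>\<^bsub>(ring_of_type_algebra :: 'a ring)\<^esub> y = x + y"
  "\<one>\<^bsub>(ring_of_type_algebra :: 'a ring)\<^esub> = 1"
  "\<zero>\<^bsub>(ring_of_type_algebra :: 'a ring)\<^esub> = 0"
  by (simp_all add: ring_of_type_algebra_def)

lemma ring_of_type_algebra_power [simp]:
  "x [^]\<^bsub>(ring_of_type_algebra :: 'a::comm_ring_1 ring)\<^esub> (n::nat) = x ^ n"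
proof -
  interpret cring "ring_of_type_algebra :: 'a ring" by (rule cring_from_type_algebra)
  show ?thesis by (induction n) (simp_all add: mult.commute)
qed

lemma principal_ideal_of_type:
  "PIdl\<^bsub>(ring_of_type_algebra :: 'a::comm_ring_1 ring)\<^esub> x = {y. x dvd y}"
  by (auto simp: cgenideal_def dvd_def mult.commute)

lemma to_fract_power [simp]: "to_fract (x ^ n) = to_fract x ^ n"
  by (induction n) simp_all

context localization_at_prime
begin

text \<open>
  The ideal generated by \<open>p\<close> and \<open>b\<close> is principal; as \<open>p\<close> is prime and does not divide \<open>b\<close>, a generator
  is a unit. The case of higher powers follows by multiplying such relations.
\<close>

lemma bezout_prime_power:
  assumes "principal_domain (ring_of_type_algebra :: 'a ring)" "\<not> p dvd b"
  obtains u v where "u * b + v * p ^ n = 1"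
proof -
  interpret principal_domain "ring_of_type_algebra :: 'a ring" by fact
  let ?I = "{u * b + v * p |u v. True}"
  have "ideal ?I (ring_of_type_algebra :: 'a ring)"
  proof (rule idealI)
    show "Ring.ring (ring_of_type_algebra :: 'a ring)" by (rule ring_axioms)
    show "subgroup ?I (add_monoid (ring_of_type_algebra :: 'a ring))"
    proof (rule group.subgroupI[OF a_group])
      show "?I \<noteq> {}" by blast
      fix x assume "x \<in> ?I"
      then obtain u v where x: "x = u * b + v * p" by blast
      have "inv\<^bsub>add_monoid (ring_of_type_algebra :: 'a ring)\<^esub> x = - x"
        unfolding a_inv_def[symmetric] by (rule minus_equality) simp_all
      also have "- x = (- u) * b + (- v) * p" by (simp add: x)
      finally show "inv\<^bsub>add_monoid (ring_of_type_algebra :: 'a ring)\<^esub> x \<in> ?I" by blast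
    next
      fix x y assume "x \<in> ?I" "y \<in> ?I"
      then obtain u v u' v' where "x = u * b + v * p" "y = u' * b + v' * p" by blast
      then have "x + y = (u + u') * b + (v + v') * p" by (simp add: algebra_simps)
      then show "x \<otimes>\<^bsub>add_monoid (ring_of_type_algebra :: 'a ring)\<^esub> y \<in> ?I" by auto
    qed simp
  next
    fix x y assume "x \<in> ?I"
    then obtain u v where "x = u * b + v * p" by blast
    then have "y * x = (y * u) * b + (y * v) * p" by (simp add: algebra_simps)
    then have "y * x \<in> ?I" by blast
    then show "y \<otimes>\<^bsub>(ring_of_type_algebra :: 'a ring)\<^esub> x \<in> ?I"
      "x \<otimes>\<^bsub>(ring_of_type_algebra :: 'a ring)\<^esub> y \<in> ?I" by (simp_all only: ring_of_type_algebra_simps mult.commute[of x y])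
  qed
  from exists_gen[OF this] obtain g where "?I = PIdl\<^bsub>(ring_of_type_algebra :: 'a ring)\<^esub> g" ..
  then have g: "?I = {y. g dvd y}" by (simp only: principal_ideal_of_type)
  have "b = 1 * b + 0 * p" "p = 0 * b + 1 * p" by simp_all
  then have "b \<in> ?I" "p \<in> ?I" by blast+
  then have "g dvd b" "g dvd p" unfolding g by simp_all
  have "\<not> p dvd g" using \<open>g dvd b\<close> assms(2) dvd_trans by blast
  moreover obtain c where c: "p = g * c" using \<open>g dvd p\<close> by blast
  ultimately have "p dvd c" using prime_elem_dvd_mult_iff[OF prime, of g c] by simp
  then obtain e where e: "c = p * e" by blast
  have "p * (g * e) = g * (p * e)" by (rule mult.left_commute)
  also have "\<dots> = p * 1" by (simp flip: e c)
  finally have "p * (g * e) = p * 1" .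
  then have "g dvd 1" by (metis dvd_triv_left mult_cancel_left p_nonzero)
  then have "1 \<in> ?I" unfolding g by simp
  then obtain u1 v1 where 1: "1 = u1 * b + v1 * p" by blast
  have "\<exists>u v. u * b + v * p ^ n = 1"
  proof (induction n)
    case 0
    show ?case by (rule exI[of _ 0], rule exI[of _ 1]) simp
  next
    case (Suc n)
    then obtain u v where "u * b + v * p ^ n = 1" by blast
    then have "u1 * b + v1 * p * (u * b + v * p ^ n) = 1" by (simp flip: 1)
    then have "(u1 + v1 * p * u) * b + (v1 * v) * p ^ Suc n = 1" by (simp add: algebra_simps)
    then show ?case by blast
  qed
  then show thesis using that by blast
qed

lemma common_denominator:
  assumes "finite F" "\<And>x. x \<in> F \<Longrightarrow> z x \<in> L"
  shows "\<exists>b c. \<not> p dvd b \<and> (\<forall>x\<in>F. to_fract b * z x = to_fract (c x))"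
  using assms
proof (induction F rule: finite_induct)
  case empty
  have "\<not> p dvd 1" using prime by (simp add: prime_elem_def)
  then show ?case by (intro exI[of _ 1]) simp
next
  case (insert y F)
  then obtain b c where bc: "\<not> p dvd b" "\<forall>x\<in>F. to_fract b * z x = to_fract (c x)" by auto
  obtain e f where ef: "\<not> p dvd f" "z y = to_fract e / to_fract f" "to_fract f \<noteq> 0"
    using insert.prems[of y] by (auto elim: localizationE)
  have "\<not> p dvd b * f" using bc(1) ef(1) prime by (simp add: prime_elem_dvd_mult_iff)
  moreover have "to_fract (b * f) * z x = to_fract (if x = y then b * e else f * c x)"
    if "x \<in> insert y F" for x
  proof (cases "x = y")
    case False
    then have "to_fract f * (to_fract b * z x) = to_fract f * to_fract (c x)" using bc(2) that by simp
    then show ?thesis using False by (simp add: mult_ac)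
  qed (use ef(2,3) in simp)
  ultimately show ?case
    by (intro exI[of _ "b * f"] exI[of _ "\<lambda>x. if x = y then b * e else f * c x"]) blast
qed

end

section \<open>Cosets of powers of the prime\<close>

text \<open>
  The residue class of \<open>s\<close> modulo \<open>p ^ n\<close>, which is also an element of the quotient of the regular
  module by the principal ideal of \<open>p ^ n\<close> (see \<open>principal_coset\<close>).
\<close>

definition power_coset :: "'a::comm_ring_1 \<Rightarrow> nat \<Rightarrow> 'a \<Rightarrow> 'a set"
  where "power_coset p n s = {t. p ^ n dvd t - s}"

lemma power_coset_eq_iff: "power_coset p n s = power_coset p n t \<longleftrightarrow> p ^ n dvd s - t"
proof
  assume "power_coset p n s = power_coset p n t"
  moreover have "s \<in> power_coset p n s" by (simp add: power_coset_def)
  ultimately show "p ^ n dvd s - t" by (simp add: power_coset_def)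
next
  assume st: "p ^ n dvd s - t"
  have "p ^ n dvd x - t \<longleftrightarrow> p ^ n dvd x - s" for x
    using dvd_add_left_iff[OF st, of "x - s"] by simp
  then show "power_coset p n s = power_coset p n t" by (simp add: power_coset_def)
qed

definition power_quotient :: "'a::idom \<Rightarrow> nat \<Rightarrow> ('a, 'a set) module"
  where "power_quotient p n = quotient_module (regular_module (ring_of_type_algebra :: 'a ring))
    (PIdl\<^bsub>(ring_of_type_algebra :: 'a ring)\<^esub> (p ^ n))"

lemma regular_module_simps [simp]:
  "carrier (regular_module R) = carrier R" "ring.add (regular_module R) = ring.add R"
  "module.smult (regular_module R) = monoid.mult R"
  by (simp_all add: regular_module_def)

lemma principal_coset:
  fixes p :: "'a::idom"
  shows "PIdl\<^bsub>(ring_of_type_algebra :: 'a ring)\<^esub> (p ^ n) +>\<^bsub>regular_module (ring_of_type_algebra :: 'a ring)\<^esub> s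
    = power_coset p n s"
proof (rule Set.set_eqI)
  fix t
  have "(\<exists>x. p ^ n dvd x \<and> t = x + s) \<longleftrightarrow> p ^ n dvd t - s"
    by (metis add_diff_cancel_right' diff_add_cancel)
  then show "t \<in> PIdl\<^bsub>(ring_of_type_algebra :: 'a ring)\<^esub> (p ^ n) +>\<^bsub>regular_module (ring_of_type_algebra :: 'a ring)\<^esub> s
      \<longleftrightarrow> t \<in> power_coset p n s"
    by (simp add: a_r_coset_def' principal_ideal_of_type power_coset_def)
qed

lemma carrier_quotient: "carrier (power_quotient p n) = range (power_coset p n)"
  by (auto simp: power_quotient_def quotient_module_def A_RCOSETS_def' principal_coset)

lemma add_quotient: "power_coset p n s \<oplus>\<^bsub>power_quotient p n\<^esub> power_coset p n t = power_coset p n (s + t)"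
proof -
  have "(\<exists>x y. p ^ n dvd x - s \<and> p ^ n dvd y - t \<and> z = x + y) \<longleftrightarrow> p ^ n dvd z - (s + t)" for z
  proof
    assume "\<exists>x y. p ^ n dvd x - s \<and> p ^ n dvd y - t \<and> z = x + y"
    then obtain x y where "p ^ n dvd (x - s) + (y - t)" "z = x + y" using dvd_add by blast
    then show "p ^ n dvd z - (s + t)" by (simp add: algebra_simps)
  next
    assume "p ^ n dvd z - (s + t)"
    then show "\<exists>x y. p ^ n dvd x - s \<and> p ^ n dvd y - t \<and> z = x + y"
      by (intro exI[of _ "z - t"] exI[of _ t]) (simp add: algebra_simps)
  qed
  then have "power_coset p n (s + t) = {z. \<exists>x\<in>power_coset p n s. \<exists>y\<in>power_coset p n t. z = x + y}"
    by (simp add: power_coset_def Bex_def)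
  then show ?thesis
    by (auto simp: power_quotient_def quotient_module_def set_add_def')
qed

lemma smult_quotient: "r \<odot>\<^bsub>power_quotient p n\<^esub> power_coset p n s = power_coset p n (r * s)"
proof -
  have eq: "power_coset p n (r * x) = power_coset p n (r * s)" if "x \<in> power_coset p n s" for x
  proof -
    have "p ^ n dvd r * (x - s)" using that by (simp add: power_coset_def)
    then show ?thesis by (simp add: power_coset_eq_iff algebra_simps)
  qed
  have "s \<in> power_coset p n s" by (simp add: power_coset_def)
  then have "(\<Union>x\<in>power_coset p n s. power_coset p n (r * x)) = power_coset p n (r * s)"
    using eq by blast
  then show ?thesis
    by (simp add: power_quotient_def quotient_module_def principal_coset)
qed

context localization_at_prime
begin

text \<open>
  The isomorphism from the quotient of the localization by \<open>p ^ n\<close> to the quotient of the ring: a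
  representative in the ring is chosen, which exists by Bezout.
\<close>

definition residue :: "nat \<Rightarrow> 'a fract \<Rightarrow> 'a set"
  where "residue n x = power_coset p n (SOME s. \<exists>l\<in>L. x = to_fract s + \<pi> ^ n * l)"

lemma localization_dvd_to_fract:
  assumes "l \<in> L" "to_fract a = \<pi> ^ n * l"
  shows "p ^ n dvd a"
proof -
  obtain c b where l: "\<not> p dvd b" "l = to_fract c / to_fract b" "to_fract b \<noteq> 0"
    using assms(1) by (rule localizationE)
  have "to_fract (a * b) = to_fract (p ^ n * c)"
    using assms(2) l(2,3) by (simp add: field_simps)
  then have "a * b = p ^ n * c" by (simp only: to_fract_eq_iff)
  then show ?thesis
  proof (induction n arbitrary: a)
    case (Suc n)
    then have "p dvd a * b" by simp
    then have "p dvd a" using l(1) prime by (simp add: prime_elem_dvd_mult_iff)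
    then obtain a' where a': "a = p * a'" by blast
    then have "p * (a' * b) = p * (p ^ n * c)" using Suc.prems by (simp add: mult_ac)
    then have "a' * b = p ^ n * c" by simp
    then show ?case using Suc.IH a' by simp
  qed simp
qed

context
  assumes pid: "principal_domain (ring_of_type_algebra :: 'a ring)"
begin

lemma residue_exists:
  assumes "x \<in> L"
  shows "\<exists>s. \<exists>l\<in>L. x = to_fract s + \<pi> ^ n * l"
proof -
  obtain a b where x: "\<not> p dvd b" "x = to_fract a / to_fract b" "to_fract b \<noteq> 0"
    using assms by (rule localizationE)
  obtain u v where uv: "u * b + v * p ^ n = 1" using bezout_prime_power[OF pid x(1)] .
  have "x * to_fract (u * b + v * p ^ n) = to_fract (u * a) + \<pi> ^ n * (to_fract v * x)"
    using x(2,3) by (simp add: field_simps)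
  then have "x = to_fract (u * a) + \<pi> ^ n * (to_fract v * x)" by (simp only: uv to_fract_1 mult_1_right)
  moreover have "to_fract v * x \<in> L" using assms by blast
  ultimately show ?thesis by blast
qed

lemma residue_eqI:
  assumes "x \<in> L" "l \<in> L" "x = to_fract s + \<pi> ^ n * l"
  shows "residue n x = power_coset p n s"
proof -
  obtain l' where l': "l' \<in> L" "x = to_fract (SOME s. \<exists>l\<in>L. x = to_fract s + \<pi> ^ n * l) + \<pi> ^ n * l'"
    using someI_ex[OF residue_exists[OF assms(1), of n]] by blast
  have "to_fract ((SOME s. \<exists>l\<in>L. x = to_fract s + \<pi> ^ n * l) - s) = \<pi> ^ n * (l - l')"
    using l'(2) assms(3) by (simp add: algebra_simps)
  then have "p ^ n dvd (SOME s. \<exists>l\<in>L. x = to_fract s + \<pi> ^ n * l) - s"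
    using localization_dvd_to_fract[of "l - l'"] assms(2) l'(1) by blast
  then show ?thesis by (simp add: residue_def power_coset_eq_iff)
qed

lemma residueE:
  assumes "x \<in> L"
  obtains s l where "l \<in> L" "x = to_fract s + \<pi> ^ n * l" "residue n x = power_coset p n s"
  using residue_exists[OF assms, of n] residue_eqI[OF assms] by blast

lemma residue_eq_iff:
  assumes "x \<in> L" "y \<in> L"
  shows "residue n x = residue n y \<longleftrightarrow> (\<exists>l\<in>L. x - y = \<pi> ^ n * l)"
proof -
  obtain s l where s: "l \<in> L" "x = to_fract s + \<pi> ^ n * l" "residue n x = power_coset p n s"
    using residueE[OF assms(1)] .
  obtain t k where t: "k \<in> L" "y = to_fract t + \<pi> ^ n * k" "residue n y = power_coset p n t"
    using residueE[OF assms(2)] .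
  show ?thesis
  proof
    assume "residue n x = residue n y"
    then have "p ^ n dvd s - t" by (simp add: s(3) t(3) power_coset_eq_iff)
    then obtain c where "s - t = p ^ n * c" by blast
    then have "to_fract (s - t) = to_fract (p ^ n * c)" by (simp only:)
    then have "x - y = \<pi> ^ n * (to_fract c + l - k)"
      by (simp add: s t algebra_simps)
    moreover have "to_fract c + l - k \<in> L" using s t by blast
    ultimately show "\<exists>l\<in>L. x - y = \<pi> ^ n * l" by blast
  next
    assume "\<exists>l\<in>L. x - y = \<pi> ^ n * l"
    then obtain l' where "l' \<in> L" "x = y + \<pi> ^ n * l'" by (auto simp: algebra_simps)
    then have "x = to_fract t + \<pi> ^ n * (k + l')" "k + l' \<in> L"
      using t by (auto simp: algebra_simps)
    then show "residue n x = residue n y" using residue_eqI[OF assms(1)] t(3) by blast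
  qed
qed

lemma residue_quotient:
  assumes "x \<in> L" "y \<in> L"
  shows "residue n x \<in> carrier (power_quotient p n)" "residue n (x + y) = residue n x \<oplus>\<^bsub>power_quotient p n\<^esub> residue n y"
    "residue n (to_fract r * x) = r \<odot>\<^bsub>power_quotient p n\<^esub> residue n x"
proof -
  obtain s l where s: "l \<in> L" "x = to_fract s + \<pi> ^ n * l" "residue n x = power_coset p n s"
    using residueE[OF assms(1)] .
  obtain t k where t: "k \<in> L" "y = to_fract t + \<pi> ^ n * k" "residue n y = power_coset p n t"
    using residueE[OF assms(2)] .
  show "residue n x \<in> carrier (power_quotient p n)" by (simp add: carrier_quotient residue_def)
  have "residue n (x + y) = power_coset p n (s + t)"
    by (rule residue_eqI[OF add_in_L[OF assms] add_in_L[OF s(1) t(1)]]) (simp add: s(2) t(2) algebra_simps)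
  then show "residue n (x + y) = residue n x \<oplus>\<^bsub>power_quotient p n\<^esub> residue n y"
    by (simp add: s(3) t(3) add_quotient)
  have "residue n (to_fract r * x) = power_coset p n (r * s)"
    by (rule residue_eqI[OF mult_in_L[OF to_fract_in_L assms(1)] mult_in_L[OF to_fract_in_L s(1), of r]])
      (simp add: s(2) algebra_simps)
  then show "residue n (to_fract r * x) = r \<odot>\<^bsub>power_quotient p n\<^esub> residue n x"
    by (simp add: s(3) smult_quotient)
qed

end

end

section \<open>Coordinates in a free module\<close>

locale free_module =
  fixes M :: "('a::idom, 'm) module" and B :: "'m set"
  assumes M_module: "Module.module (ring_of_type_algebra :: 'a ring) M"
    and basis: "finite_basis (ring_of_type_algebra :: 'a ring) M B"
begin

sublocale M: Module.module "ring_of_type_algebra :: 'a ring" M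
  by (rule M_module)

abbreviation coords :: "'m \<Rightarrow> 'm \<Rightarrow> 'a"
  where "coords \<equiv> coordinates (ring_of_type_algebra :: 'a ring) M B"

lemma finite_B [simp]: "finite B"
  using basis unfolding finite_basis_def by (elim conjE)

lemma B_carrier: "b \<in> B \<Longrightarrow> b \<in> carrier M"
  using basis unfolding finite_basis_def by (elim conjE) (rule subsetD)

lemma coordinates_exist_uniquely:
  "w \<in> carrier M \<Longrightarrow> \<exists>!c. is_coordinates (ring_of_type_algebra :: 'a ring) M B w c"
  using basis unfolding finite_basis_def by (elim conjE) (rule bspec)

lemma is_coordinates_coords:
  "w \<in> carrier M \<Longrightarrow> is_coordinates (ring_of_type_algebra :: 'a ring) M B w (coords w)"
  unfolding coordinates_def by (rule theI'[OF coordinates_exist_uniquely])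

lemma coords_unique:
  assumes "w \<in> carrier M" "is_coordinates (ring_of_type_algebra :: 'a ring) M B w c"
  shows "coords w = c"
  using coordinates_exist_uniquely[OF assms(1)] is_coordinates_coords[OF assms(1)] assms(2)
  by (elim ex1E) metis

definition linear_combination :: "('m \<Rightarrow> 'a) \<Rightarrow> 'm set \<Rightarrow> 'm"
  where "linear_combination c F = (\<Oplus>\<^bsub>M\<^esub>b\<in>F. c b \<odot>\<^bsub>M\<^esub> b)"

lemma linear_combination_in_carrier:
  "F \<subseteq> B \<Longrightarrow> linear_combination c F \<in> carrier M"
  unfolding linear_combination_def using B_carrier by (intro M.M.finsum_closed) auto

lemma coords_linear_combination: "b \<in> B \<Longrightarrow> coords (linear_combination c B) b = c b"
proof -
  have "linear_combination (restrict c B) B = linear_combination c B"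
    unfolding linear_combination_def using B_carrier by (intro M.M.finsum_cong') auto
  then have "coords (linear_combination c B) = restrict c B"
    by (intro coords_unique linear_combination_in_carrier)
      (auto simp: is_coordinates_def linear_combination_def)
  then show "b \<in> B \<Longrightarrow> ?thesis" by simp
qed

lemma linear_combination_coords: "w \<in> carrier M \<Longrightarrow> linear_combination (coords w) B = w"
  using is_coordinates_coords by (simp add: is_coordinates_def linear_combination_def)

lemma linear_combination_add:
  assumes "F \<subseteq> B"
  shows "linear_combination (\<lambda>b. c b + e b) F = linear_combination c F \<oplus>\<^bsub>M\<^esub> linear_combination e F"
proof -
  have "linear_combination (\<lambda>b. c b + e b) F = (\<Oplus>\<^bsub>M\<^esub>b\<in>F. c b \<odot>\<^bsub>M\<^esub> b \<oplus>\<^bsub>M\<^esub> e b \<odot>\<^bsub>M\<^esub> b)"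
    unfolding linear_combination_def
    using assms B_carrier M.smult_l_distr by (intro M.M.finsum_cong') auto
  also have "\<dots> = linear_combination c F \<oplus>\<^bsub>M\<^esub> linear_combination e F"
    unfolding linear_combination_def using assms B_carrier by (intro M.M.finsum_addf) auto
  finally show ?thesis .
qed

lemma linear_combination_smult:
  assumes "F \<subseteq> B"
  shows "linear_combination (\<lambda>b. r * c b) F = r \<odot>\<^bsub>M\<^esub> linear_combination c F"
proof -
  have "linear_combination (\<lambda>b. r * c b) F = (\<Oplus>\<^bsub>M\<^esub>b\<in>F. r \<odot>\<^bsub>M\<^esub> (c b \<odot>\<^bsub>M\<^esub> b))"
    unfolding linear_combination_def
    using assms B_carrier M.smult_assoc1[of r] by (intro M.M.finsum_cong') auto
  also have "\<dots> = r \<odot>\<^bsub>M\<^esub> linear_combination c F"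
    unfolding linear_combination_def using assms B_carrier finite_subset[OF assms finite_B]
    by (intro M.finsum_smult_ldistr[symmetric]) auto
  finally show ?thesis .
qed

lemma coords_add:
  assumes "w \<in> carrier M" "w' \<in> carrier M" "b \<in> B"
  shows "coords (w \<oplus>\<^bsub>M\<^esub> w') b = coords w b + coords w' b"
  using linear_combination_add[of B "coords w" "coords w'"]
    coords_linear_combination[OF assms(3), of "\<lambda>b. coords w b + coords w' b"]
  by (simp add: linear_combination_coords assms)

lemma coords_smult:
  assumes "w \<in> carrier M" "b \<in> B"
  shows "coords (r \<odot>\<^bsub>M\<^esub> w) b = r * coords w b"
  using linear_combination_smult[of B r "coords w"]
    coords_linear_combination[OF assms(2), of "\<lambda>b. r * coords w b"]
  by (simp add: linear_combination_coords assms)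

lemma coords_basis:
  assumes "v \<in> B" "b \<in> B"
  shows "coords v b = (if b = v then 1 else 0)"
proof -
  have "linear_combination (\<lambda>b. if b = v then 1 else 0) B = (\<Oplus>\<^bsub>M\<^esub>b\<in>B. if v = b then b else \<zero>\<^bsub>M\<^esub>)"
    unfolding linear_combination_def using B_carrier M.smult_one M.smult_l_null
    by (intro M.M.finsum_cong') auto
  also have "\<dots> = v" using assms(1) B_carrier by (intro M.M.finsum_singleton) auto
  finally show ?thesis using coords_linear_combination[OF assms(2), of "\<lambda>b. if b = v then 1 else 0"] by simp
qed

text \<open>
  This translates elements of the module into functions with values in the fraction field. It is linear
  and injective, so identities in the module are checked on functions.
\<close>

definition localized_chain :: "'m \<Rightarrow> 'm \<Rightarrow> 'a fract"
  where "localized_chain w x = (if x \<in> B then to_fract (coords w x) else 0)"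

lemma localized_chain_add:
  assumes "w \<in> carrier M" "w' \<in> carrier M"
  shows "localized_chain (w \<oplus>\<^bsub>M\<^esub> w') x = localized_chain w x + localized_chain w' x"
  by (simp add: localized_chain_def coords_add assms)

lemma localized_chain_smult:
  assumes "w \<in> carrier M"
  shows "localized_chain (r \<odot>\<^bsub>M\<^esub> w) x = to_fract r * localized_chain w x"
  by (simp add: localized_chain_def coords_smult assms)

lemma localized_chain_zero: "localized_chain \<zero>\<^bsub>M\<^esub> x = 0"
  using localized_chain_smult[of "\<zero>\<^bsub>M\<^esub>" 0 x] M.smult_l_null[of "\<zero>\<^bsub>M\<^esub>"] by simp

lemma localized_chain_inj:
  assumes "w \<in> carrier M" "w' \<in> carrier M" "localized_chain w = localized_chain w'"
  shows "w = w'"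
proof -
  have "coords w b = coords w' b" if "b \<in> B" for b
    using fun_cong[OF assms(3), of b] that by (simp add: localized_chain_def)
  then have "linear_combination (coords w) B = linear_combination (coords w') B"
    unfolding linear_combination_def using B_carrier by (intro M.M.finsum_cong') auto
  then show ?thesis by (simp add: linear_combination_coords assms)
qed

lemma localized_chain_surj:
  obtains w where "w \<in> carrier M" "\<And>x. x \<in> B \<Longrightarrow> localized_chain w x = to_fract (c x)"
    "\<And>x. x \<notin> B \<Longrightarrow> localized_chain w x = 0"
  by (rule that[OF linear_combination_in_carrier[of B c]])
    (simp_all add: localized_chain_def coords_linear_combination)

text \<open>
  An element of a basis of the zero module would be zero, but its own coordinate is one.
\<close>

lemma zero_module_basis:
  assumes "carrier M = {\<zero>\<^bsub>M\<^esub>}"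
  shows "B = {}"
proof (rule ccontr)
  assume "B \<noteq> {}"
  then obtain b where b: "b \<in> B" by blast
  have "b = \<zero>\<^bsub>M\<^esub>" using B_carrier[OF b] assms by simp
  then show False
    using localized_chain_zero[of b] coords_basis[OF b b] b by (simp add: localized_chain_def)
qed

end

lemma module_morphism_zero:
  fixes M :: "('a::comm_ring_1, 'm) module" and M' :: "('a, 'n) module"
  assumes "Module.module (ring_of_type_algebra :: 'a ring) M"
    and "Module.module (ring_of_type_algebra :: 'a ring) M'"
    and "f \<in> module_morphisms (ring_of_type_algebra :: 'a ring) M M'"
  shows "f \<zero>\<^bsub>M\<^esub> = \<zero>\<^bsub>M'\<^esub>"
proof -
  interpret M: Module.module "ring_of_type_algebra :: 'a ring" M by fact
  interpret M': Module.module "ring_of_type_algebra :: 'a ring" M' by fact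
  have z: "0 \<odot>\<^bsub>M\<^esub> \<zero>\<^bsub>M\<^esub> = \<zero>\<^bsub>M\<^esub>" using M.smult_l_null[of "\<zero>\<^bsub>M\<^esub>"] by simp
  have "f \<in> carrier M \<rightarrow> carrier M'" "f (0 \<odot>\<^bsub>M\<^esub> \<zero>\<^bsub>M\<^esub>) = 0 \<odot>\<^bsub>M'\<^esub> f \<zero>\<^bsub>M\<^esub>"
    using assms(3) by (simp_all add: module_morphisms_def del: M.smult_r_null M'.smult_r_null M.smult_l_null M'.smult_l_null)
  then have "f \<zero>\<^bsub>M\<^esub> \<in> carrier M'" "f (0 \<odot>\<^bsub>M\<^esub> \<zero>\<^bsub>M\<^esub>) = 0 \<odot>\<^bsub>M'\<^esub> f \<zero>\<^bsub>M\<^esub>"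
    by (auto intro: funcset_mem)
  then show ?thesis using M'.smult_l_null[of "f \<zero>\<^bsub>M\<^esub>"] by (simp add: z)
qed

lemma localized_chain_morphism:
  fixes M :: "('a::idom, 'm) module" and M' :: "('a, 'n) module"
  assumes "free_module M B" "free_module M' B'"
    and f: "f \<in> module_morphisms (ring_of_type_algebra :: 'a ring) M M'"
    and "w \<in> carrier M"
  shows "free_module.localized_chain M' B' (f w) u
    = (\<Sum>v\<in>B. free_module.localized_chain M' B' (f v) u * free_module.localized_chain M B w v)"
proof -
  interpret M: free_module M B by fact
  interpret M': free_module M' B' by fact
  have f_closed: "f x \<in> carrier M'" if "x \<in> carrier M" for x
    using f that by (auto simp: module_morphisms_def)
  have f_add: "f (x \<oplus>\<^bsub>M\<^esub> y) = f x \<oplus>\<^bsub>M'\<^esub> f y" if "x \<in> carrier M" "y \<in> carrier M" for x y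
    using f that by (auto simp: module_morphisms_def)
  have f_smult: "f (r \<odot>\<^bsub>M\<^esub> x) = r \<odot>\<^bsub>M'\<^esub> f x" if "x \<in> carrier M" for r x
    using f that by (auto simp: module_morphisms_def)
  have "M'.localized_chain (f (M.linear_combination c F)) u
      = (\<Sum>v\<in>F. M'.localized_chain (f v) u * to_fract (c v))" if "F \<subseteq> B" for F c
    using finite_subset[OF that M.finite_B] that
  proof (induction F rule: finite_induct)
    case empty
    have "M.linear_combination c {} = \<zero>\<^bsub>M\<^esub>"
      by (simp add: M.linear_combination_def)
    then show ?case
      using module_morphism_zero[OF M.M_module M'.M_module f] by (simp add: M'.localized_chain_zero)
  next
    case (insert v F)
    have v: "v \<in> carrier M" and F: "F \<subseteq> B" using insert.prems M.B_carrier by auto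
    have cv: "c v \<odot>\<^bsub>M\<^esub> v \<in> carrier M" using v M.M.smult_closed[of "c v" v] by simp
    have "M.linear_combination c (insert v F) = c v \<odot>\<^bsub>M\<^esub> v \<oplus>\<^bsub>M\<^esub> M.linear_combination c F"
      unfolding M.linear_combination_def using insert.hyps F M.B_carrier cv
      by (intro M.M.M.finsum_insert) auto
    then show ?case
      using insert M.linear_combination_in_carrier[OF F, of c] cv v F f_closed
      by (simp add: f_add f_smult M'.localized_chain_add M'.localized_chain_smult mult.commute)
  qed
  from this[of B "M.coords w"] show ?thesis
    by (simp add: M.linear_combination_coords[OF assms(4)] M.localized_chain_def)
qed

section \<open>Isomorphisms from surjections with equal fibres\<close>

text \<open>
  Both modules are images of \<open>T\<close> under linear maps with the same fibres. Only the operations on \<open>T\<close> enter,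
  so \<open>T\<close> need not be made into a module of its own. The isomorphism sends the image of \<open>x\<close> under one map
  to its image under the other.
\<close>

lemma module_isomorphicI:
  assumes "carrier P = q ` T" "carrier Q = \<phi> ` T"
    and fibres: "\<And>x y. x \<in> T \<Longrightarrow> y \<in> T \<Longrightarrow> q x = q y \<longleftrightarrow> \<phi> x = \<phi> y"
    and plus: "\<And>x y. x \<in> T \<Longrightarrow> y \<in> T \<Longrightarrow> plus_T x y \<in> T"
      "\<And>x y. x \<in> T \<Longrightarrow> y \<in> T \<Longrightarrow> q (plus_T x y) = q x \<oplus>\<^bsub>P\<^esub> q y"
      "\<And>x y. x \<in> T \<Longrightarrow> y \<in> T \<Longrightarrow> \<phi> (plus_T x y) = \<phi> x \<oplus>\<^bsub>Q\<^esub> \<phi> y"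
    and scale: "\<And>r x. r \<in> carrier R \<Longrightarrow> x \<in> T \<Longrightarrow> scale_T r x \<in> T"
      "\<And>r x. r \<in> carrier R \<Longrightarrow> x \<in> T \<Longrightarrow> q (scale_T r x) = r \<odot>\<^bsub>P\<^esub> q x"
      "\<And>r x. r \<in> carrier R \<Longrightarrow> x \<in> T \<Longrightarrow> \<phi> (scale_T r x) = r \<odot>\<^bsub>Q\<^esub> \<phi> x"
  shows "module_isomorphic R P Q"
proof -
  define f where "f A = \<phi> (SOME x. x \<in> T \<and> q x = A)" for A
  have f: "f (q x) = \<phi> x" if "x \<in> T" for x
  proof -
    have "(SOME y. y \<in> T \<and> q y = q x) \<in> T \<and> q (SOME y. y \<in> T \<and> q y = q x) = q x"
      by (rule someI[of _ x]) (use that in simp)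
    then show ?thesis unfolding f_def using fibres that by blast
  qed
  have "f \<in> module_morphisms R P Q"
    unfolding module_morphisms_def
    using f plus scale by (auto simp: assms(1,2) plus(2)[symmetric] scale(2)[symmetric])
  moreover have "bij_betw f (carrier P) (carrier Q)"
    unfolding bij_betw_def
    using f fibres by (force simp: assms(1,2) inj_on_def image_image)
  ultimately show ?thesis unfolding module_isomorphic_def by blast
qed

section \<open>The torsion of the homology\<close>

locale based_chain_complex = localization_at_prime p for p :: "'a::idom" +
  fixes N :: nat and C :: "nat \<Rightarrow> ('a, 'm) module" and d :: "nat \<Rightarrow> 'm \<Rightarrow> 'm" and I :: "nat \<Rightarrow> 'm set"
  assumes pid: "principal_domain (ring_of_type_algebra :: 'a ring)"
    and complex: "chain_complex (ring_of_type_algebra :: 'a ring) N C d"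
    and bases: "finite_basis (ring_of_type_algebra :: 'a ring) (C k) (I k)"
begin

text \<open>
  The embedding \<open>\<kappa> k\<close> below turns elements of \<open>C k\<close> into chains of the localized complex.
\<close>

abbreviation "R \<equiv> (ring_of_type_algebra :: 'a ring)"
abbreviation "D0 \<equiv> localized_complex C I d"

lemma free: "free_module (C k) (I k)"
  using complex bases by (simp add: free_module_def chain_complex_def)

sublocale C: free_module "C k" "I k" for k
  by (rule free)

abbreviation \<kappa> :: "nat \<Rightarrow> 'm \<Rightarrow> 'm \<Rightarrow> 'a fract"
  where "\<kappa> k \<equiv> free_module.localized_chain (C k) (I k)"

lemma chain_eqI:
  assumes "w \<in> carrier (C k)" "w' \<in> carrier (C k)" "\<And>x. \<kappa> k w x = \<kappa> k w' x"
  shows "w = w'"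
  by (rule C.localized_chain_inj[OF assms(1,2)]) (simp add: assms(3) fun_eq_iff)

lemma d_morphism: "d (Suc k) \<in> module_morphisms R (C (Suc k)) (C k)"
proof -
  have "\<forall>k\<ge>1. d k \<in> module_morphisms R (C k) (C (k - 1))"
    using complex by (simp add: chain_complex_def)
  from this[rule_format, of "Suc k"] show ?thesis by simp
qed

lemma d_closed: "w \<in> carrier (C (Suc k)) \<Longrightarrow> d (Suc k) w \<in> carrier (C k)"
  using d_morphism[of k] unfolding module_morphisms_def by blast

lemma d_add: "\<lbrakk>w \<in> carrier (C (Suc k)); w' \<in> carrier (C (Suc k))\<rbrakk> \<Longrightarrow>
    d (Suc k) (w \<oplus>\<^bsub>C (Suc k)\<^esub> w') = d (Suc k) w \<oplus>\<^bsub>C k\<^esub> d (Suc k) w'"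
  using d_morphism[of k] unfolding module_morphisms_def by blast

lemma d_smult: "w \<in> carrier (C (Suc k)) \<Longrightarrow> d (Suc k) (r \<odot>\<^bsub>C (Suc k)\<^esub> w) = r \<odot>\<^bsub>C k\<^esub> d (Suc k) w"
  using d_morphism[of k] unfolding module_morphisms_def by simp

lemma d_d: "w \<in> carrier (C (Suc (Suc k))) \<Longrightarrow> d (Suc k) (d (Suc (Suc k)) w) = \<zero>\<^bsub>C k\<^esub>"
proof -
  have "\<forall>k\<ge>2. \<forall>x \<in> carrier (C k). d (k - 1) (d k x) = \<zero>\<^bsub>C (k - 2)\<^esub>"
    using complex by (simp add: chain_complex_def)
  from this[rule_format, of "Suc (Suc k)"] show "w \<in> carrier (C (Suc (Suc k))) \<Longrightarrow> ?thesis"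
    by simp
qed

lemma basis_localized [simp]: "basis D0 k = I k"
  by (simp add: localized_complex_def)

lemma smult_carrier [simp]: "w \<in> carrier (C k) \<Longrightarrow> r \<odot>\<^bsub>C k\<^esub> w \<in> carrier (C k)"
  using C.M.smult_closed[of r w k] by simp

lemma boundary_chain:
  assumes "w \<in> carrier (C (Suc k))"
  shows "boundary D0 (Suc k) (\<kappa> (Suc k) w) = \<kappa> k (d (Suc k) w)"
proof
  fix u
  show "boundary D0 (Suc k) (\<kappa> (Suc k) w) u = \<kappa> k (d (Suc k) w) u"
  proof (cases "u \<in> I k")
    case True
    then show ?thesis
      unfolding localized_chain_morphism[OF free free d_morphism assms]
      by (simp add: boundary_def localized_complex_def C.localized_chain_def)
  next
    case False
    then show ?thesis by (simp add: boundary_def C.localized_chain_def)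
  qed
qed

lemma chain_in_chains: "\<kappa> k w \<in> chains p D0 k"
  by (simp add: chains_def C.localized_chain_def)

text \<open>
  The finitely many coordinates have a common denominator, and coordinates can be prescribed in \<open>C k\<close>.
\<close>

lemma chain_denominator:
  assumes "z \<in> chains p D0 k"
  shows "\<exists>b w. \<not> p dvd b \<and> w \<in> carrier (C k) \<and> (\<forall>x. \<kappa> k w x = to_fract b * z x)"
proof -
  have "\<exists>b c. \<not> p dvd b \<and> (\<forall>x\<in>I k. to_fract b * z x = to_fract (c x))"
    by (rule common_denominator) (use assms in \<open>simp_all add: chains_def\<close>)
  then obtain b c where bc: "\<not> p dvd b" "\<forall>x\<in>I k. to_fract b * z x = to_fract (c x)" by (elim exE conjE)
  obtain w where w: "w \<in> carrier (C k)" "\<And>x. x \<in> I k \<Longrightarrow> \<kappa> k w x = to_fract (c x)"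
    "\<And>x. x \<notin> I k \<Longrightarrow> \<kappa> k w x = 0"
    by (rule C.localized_chain_surj[of k c]) blast
  have "\<kappa> k w x = to_fract b * z x" for x
    using w(2,3)[of x] bc(2) assms by (cases "x \<in> I k") (simp_all add: chains_def)
  with bc(1) w(1) show ?thesis by (intro exI[of _ b] exI[of _ w]) simp
qed

text \<open>
  The square of the boundary vanishes for the elements of \<open>C\<close>, in particular for the basis elements,
  and therefore for all linear combinations over the fraction field.
\<close>

lemma localized_local_complex: "local_complex p D0"
proof
  show "finite (basis D0 k)" for k by simp
  have "basis D0 k = {}" if "k > N" for k
    using complex that C.zero_module_basis[of k] by (simp add: chain_complex_def)
  then show "\<exists>N. \<forall>k>N. basis D0 k = {}" by blast
  show "bdry D0 k u v \<in> L" for k u v by (simp add: localized_complex_def)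
  show "boundary D0 k (boundary D0 (Suc k) z) u = 0" for k z u
  proof (cases k)
    case 0
    then show ?thesis by (simp add: boundary_def)
  next
    case (Suc l)
    have "boundary D0 (Suc k) z = boundary D0 (Suc k) (\<lambda>x. \<Sum>v\<in>I (Suc k). z v * \<kappa> (Suc k) v x)"
    proof (rule boundary_cong)
      fix x assume x: "x \<in> basis D0 (Suc k)"
      have "(\<Sum>v\<in>I (Suc k). z v * \<kappa> (Suc k) v x) = (\<Sum>v\<in>I (Suc k). if v = x then z v else 0)"
        using x by (intro sum.cong) (auto simp: C.localized_chain_def C.coords_basis)
      then show "z x = (\<Sum>v\<in>I (Suc k). z v * \<kappa> (Suc k) v x)" using x by simp
    qed
    also have "\<dots> = (\<lambda>x. \<Sum>v\<in>I (Suc k). z v * \<kappa> k (d (Suc k) v) x)"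
      by (rule ext) (simp add: boundary_sum boundary_scale boundary_chain C.B_carrier)
    finally have "boundary D0 k (boundary D0 (Suc k) z) u
        = (\<Sum>v\<in>I (Suc k). z v * boundary D0 k (\<kappa> k (d (Suc k) v)) u)"
      by (simp add: boundary_sum boundary_scale)
    also have "\<dots> = 0"
      using Suc by (intro sum.neutral) (simp add: boundary_chain d_closed C.B_carrier d_d C.localized_chain_zero)
    finally show ?thesis .
  qed
qed

definition bounds :: "nat \<Rightarrow> 'm set"
  where "bounds k = d (Suc k) ` carrier (C (Suc k))"

definition torsion_chains :: "nat \<Rightarrow> 'm set"
  where "torsion_chains k = {w \<in> carrier (C k). \<exists>s. p ^ s \<odot>\<^bsub>C k\<^esub> w \<in> bounds k}"

lemma bounds_carrier: "b \<in> bounds k \<Longrightarrow> b \<in> carrier (C k)"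
  by (auto simp: bounds_def d_closed)

lemma bounds_add: "b \<in> bounds k \<Longrightarrow> b' \<in> bounds k \<Longrightarrow> b \<oplus>\<^bsub>C k\<^esub> b' \<in> bounds k"
  unfolding bounds_def by (auto simp flip: d_add)

lemma bounds_smult: "b \<in> bounds k \<Longrightarrow> r \<odot>\<^bsub>C k\<^esub> b \<in> bounds k"
  unfolding bounds_def by (auto simp flip: d_smult)

lemma torsion_chains_smult:
  assumes "w \<in> torsion_chains k"
  shows "r \<odot>\<^bsub>C k\<^esub> w \<in> torsion_chains k"
proof -
  obtain s where w: "w \<in> carrier (C k)" "p ^ s \<odot>\<^bsub>C k\<^esub> w \<in> bounds k"
    using assms by (auto simp: torsion_chains_def)
  have "p ^ s \<odot>\<^bsub>C k\<^esub> (r \<odot>\<^bsub>C k\<^esub> w) = r \<odot>\<^bsub>C k\<^esub> (p ^ s \<odot>\<^bsub>C k\<^esub> w)"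
    by (rule chain_eqI[where k = k]) (simp_all add: w C.localized_chain_smult mult.left_commute)
  also have "\<dots> \<in> bounds k" by (rule bounds_smult[OF w(2)])
  finally show ?thesis using w by (auto simp: torsion_chains_def)
qed

lemma torsion_chains_add:
  assumes "w \<in> torsion_chains k" "w' \<in> torsion_chains k"
  shows "w \<oplus>\<^bsub>C k\<^esub> w' \<in> torsion_chains k"
proof -
  obtain s where w: "w \<in> carrier (C k)" "p ^ s \<odot>\<^bsub>C k\<^esub> w \<in> bounds k"
    using assms(1) by (auto simp: torsion_chains_def)
  obtain s' where w': "w' \<in> carrier (C k)" "p ^ s' \<odot>\<^bsub>C k\<^esub> w' \<in> bounds k"
    using assms(2) by (auto simp: torsion_chains_def)
  have "p ^ (s + s') \<odot>\<^bsub>C k\<^esub> (w \<oplus>\<^bsub>C k\<^esub> w')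
      = p ^ s' \<odot>\<^bsub>C k\<^esub> (p ^ s \<odot>\<^bsub>C k\<^esub> w) \<oplus>\<^bsub>C k\<^esub> p ^ s \<odot>\<^bsub>C k\<^esub> (p ^ s' \<odot>\<^bsub>C k\<^esub> w')"
    by (rule chain_eqI[where k = k])
      (simp_all add: w w' C.localized_chain_smult C.localized_chain_add power_add algebra_simps)
  also have "\<dots> \<in> bounds k" by (rule bounds_add[OF bounds_smult[OF w(2)] bounds_smult[OF w'(2)]])
  finally show ?thesis using w w' by (auto simp: torsion_chains_def)
qed

lemma bounds_torsion: "b \<in> bounds k \<Longrightarrow> b \<in> torsion_chains k"
  using bounds_carrier bounds_smult by (auto simp: torsion_chains_def)

text \<open>
  If \<open>w\<close> is a boundary over the localization, then \<open>b w\<close> is a boundary for some \<open>b\<close> which \<open>p\<close> does not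
  divide. Also \<open>p ^ s w\<close> is a boundary for some \<open>s\<close>, and by Bezout \<open>w\<close> is a combination of both.
\<close>

lemma torsion_chain_is_boundary:
  assumes w: "w \<in> torsion_chains k" and z: "\<kappa> k w \<in> boundary D0 (Suc k) ` chains p D0 (Suc k)"
  shows "w \<in> bounds k"
proof -
  obtain s where s: "w \<in> carrier (C k)" "p ^ s \<odot>\<^bsub>C k\<^esub> w \<in> bounds k"
    using w by (auto simp: torsion_chains_def)
  obtain c where c: "c \<in> chains p D0 (Suc k)" "\<kappa> k w = boundary D0 (Suc k) c" using z by blast
  obtain b x where b: "\<not> p dvd b" "x \<in> carrier (C (Suc k))" "\<forall>y. \<kappa> (Suc k) x y = to_fract b * c y"
    using chain_denominator[OF c(1)] by (elim exE conjE)
  have e: "\<kappa> (Suc k) x = (\<lambda>y. to_fract b * c y)" using b(3) by (simp add: fun_eq_iff)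
  have "\<kappa> k (d (Suc k) x) = \<kappa> k (b \<odot>\<^bsub>C k\<^esub> w)"
    unfolding boundary_chain[OF b(2), symmetric] e
    by (simp add: fun_eq_iff boundary_scale C.localized_chain_smult s flip: c(2))
  then have "d (Suc k) x = b \<odot>\<^bsub>C k\<^esub> w"
    using d_closed[OF b(2)] s(1) by (intro C.localized_chain_inj) simp_all
  then have bw: "b \<odot>\<^bsub>C k\<^esub> w \<in> bounds k" unfolding bounds_def using b(2) by (metis imageI)
  obtain u v where uv: "u * b + v * p ^ s = 1" using bezout_prime_power[OF pid b(1)] .
  have "w = u \<odot>\<^bsub>C k\<^esub> (b \<odot>\<^bsub>C k\<^esub> w) \<oplus>\<^bsub>C k\<^esub> v \<odot>\<^bsub>C k\<^esub> (p ^ s \<odot>\<^bsub>C k\<^esub> w)"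
  proof (rule chain_eqI[where k = k])
    fix y
    have "\<kappa> k w y = to_fract (u * b + v * p ^ s) * \<kappa> k w y" by (simp only: uv) simp
    then show "\<kappa> k w y = \<kappa> k (u \<odot>\<^bsub>C k\<^esub> (b \<odot>\<^bsub>C k\<^esub> w) \<oplus>\<^bsub>C k\<^esub> v \<odot>\<^bsub>C k\<^esub> (p ^ s \<odot>\<^bsub>C k\<^esub> w)) y"
      by (simp add: C.localized_chain_add C.localized_chain_smult s algebra_simps)
  qed (simp_all add: s)
  also have "\<dots> \<in> bounds k" by (rule bounds_add[OF bounds_smult[OF bw] bounds_smult[OF s(2)]])
  finally show ?thesis .
qed

lemma bounds_cycles: "b \<in> bounds k \<Longrightarrow> b \<in> cycles C d k"
  by (cases k) (auto simp: cycles_def bounds_def d_closed a_kernel_def' d_d)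

text \<open>
  A multiple of \<open>d w\<close> by a power of \<open>p\<close> vanishes, and a free module over a domain has no torsion.
\<close>

lemma torsion_chains_cycles:
  assumes "w \<in> torsion_chains k"
  shows "w \<in> cycles C d k"
proof (cases k)
  case 0
  then show ?thesis using assms by (simp add: cycles_def torsion_chains_def)
next
  case (Suc l)
  obtain s where s: "w \<in> carrier (C k)" "p ^ s \<odot>\<^bsub>C k\<^esub> w \<in> bounds k"
    using assms by (auto simp: torsion_chains_def)
  have "p ^ s \<odot>\<^bsub>C l\<^esub> d k w = d k (p ^ s \<odot>\<^bsub>C k\<^esub> w)" using s(1) Suc by (simp add: d_smult)
  also have "\<dots> = \<zero>\<^bsub>C l\<^esub>" using bounds_cycles[OF s(2)] Suc by (simp add: cycles_def a_kernel_def')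
  finally have "\<pi> ^ s * \<kappa> l (d k w) x = 0" for x
    using C.localized_chain_smult[of "d k w" l "p ^ s" x] s(1) Suc
    by (simp add: d_closed C.localized_chain_zero)
  then have "\<kappa> l (d k w) = \<kappa> l \<zero>\<^bsub>C l\<^esub>" by (simp add: fun_eq_iff C.localized_chain_zero)
  then have "d k w = \<zero>\<^bsub>C l\<^esub>"
    using d_closed[of w l] s(1) Suc by (intro C.localized_chain_inj) simp_all
  then show ?thesis using s(1) Suc by (simp add: cycles_def a_kernel_def')
qed

definition homology_class :: "nat \<Rightarrow> 'm \<Rightarrow> 'm set"
  where "homology_class k w = bounds k +>\<^bsub>C k\<^esub> w"

lemma bounds_subgroup: "abelian_subgroup (bounds k) (C k)"
proof (rule abelian_subgroupI3)
  show "abelian_group (C k)" by (rule C.M.abelian_group_axioms)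
  show "additive_subgroup (bounds k) (C k)"
  proof (rule additive_subgroup.intro, rule group.subgroupI)
    show "group (add_monoid (C k))" by (rule C.M.a_group)
    show "bounds k \<subseteq> carrier (add_monoid (C k))" by (auto simp: bounds_carrier)
    show "bounds k \<noteq> {}" using C.M.zero_closed[of "Suc k"] by (auto simp: bounds_def)
    show "b \<otimes>\<^bsub>add_monoid (C k)\<^esub> b' \<in> bounds k" if "b \<in> bounds k" "b' \<in> bounds k" for b b'
      using bounds_add[OF that] by simp
    show "inv\<^bsub>add_monoid (C k)\<^esub> b \<in> bounds k" if b: "b \<in> bounds k" for b
    proof -
      have "(- 1) \<odot>\<^bsub>C k\<^esub> b \<oplus>\<^bsub>C k\<^esub> b = \<zero>\<^bsub>C k\<^esub>"
        by (rule chain_eqI[where k = k])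
          (simp_all add: bounds_carrier[OF b] C.localized_chain_add C.localized_chain_smult C.localized_chain_zero)
      then have "\<ominus>\<^bsub>C k\<^esub> b = (- 1) \<odot>\<^bsub>C k\<^esub> b"
        by (rule C.M.M.minus_equality) (simp_all add: bounds_carrier[OF b])
      then show ?thesis using bounds_smult[OF b, of "- 1"] by (simp add: a_inv_def)
    qed
  qed
qed

lemma homology_class_eq_iff:
  assumes "w \<in> carrier (C k)" "w' \<in> carrier (C k)"
  shows "homology_class k w = homology_class k w' \<longleftrightarrow> (\<exists>b\<in>bounds k. w = b \<oplus>\<^bsub>C k\<^esub> w')"
proof -
  interpret abelian_subgroup "bounds k" "C k" by (rule bounds_subgroup)
  have mem: "x \<in> homology_class k w' \<longleftrightarrow> (\<exists>b\<in>bounds k. x = b \<oplus>\<^bsub>C k\<^esub> w')" for x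
    by (auto simp: homology_class_def a_r_coset_def')
  show ?thesis
  proof
    assume "homology_class k w = homology_class k w'"
    moreover have "w \<in> homology_class k w" unfolding homology_class_def by (rule a_rcos_self[OF assms(1)])
    ultimately show "\<exists>b\<in>bounds k. w = b \<oplus>\<^bsub>C k\<^esub> w'" using mem by simp
  next
    assume "\<exists>b\<in>bounds k. w = b \<oplus>\<^bsub>C k\<^esub> w'"
    then have "w \<in> bounds k +>\<^bsub>C k\<^esub> w'" using mem by (simp add: homology_class_def)
    then show "homology_class k w = homology_class k w'"
      unfolding homology_class_def by (rule a_repr_independence'[symmetric, OF _ assms(2)])
  qed
qed

lemma homology_bounds: "homology C d k = quotient_module ((C k)\<lparr>carrier := cycles C d k\<rparr>) (bounds k)"
  by (simp add: homology_def bounds_def Suc_eq_plus1)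

lemma carrier_homology: "carrier (homology C d k) = homology_class k ` cycles C d k"
proof -
  have "bounds k +>\<^bsub>(C k)\<lparr>carrier := cycles C d k\<rparr>\<^esub> w = homology_class k w" for w
    by (simp add: homology_class_def a_r_coset_def')
  then show ?thesis
    by (auto simp: homology_bounds quotient_module_def A_RCOSETS_def')
qed

lemma zero_homology: "\<zero>\<^bsub>homology C d k\<^esub> = bounds k"
  by (simp add: homology_bounds quotient_module_def)

lemma add_homology:
  assumes "w \<in> carrier (C k)" "w' \<in> carrier (C k)"
  shows "homology_class k w \<oplus>\<^bsub>homology C d k\<^esub> homology_class k w' = homology_class k (w \<oplus>\<^bsub>C k\<^esub> w')"
proof -
  interpret abelian_subgroup "bounds k" "C k" by (rule bounds_subgroup)
  have "homology_class k w \<oplus>\<^bsub>homology C d k\<^esub> homology_class k w'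
      = homology_class k w <+>\<^bsub>C k\<^esub> homology_class k w'"
    by (simp add: homology_bounds quotient_module_def set_add_def')
  then show ?thesis unfolding homology_class_def by (simp only: a_rcos_sum[OF assms])
qed

lemma smult_homology:
  assumes "w \<in> carrier (C k)"
  shows "r \<odot>\<^bsub>homology C d k\<^esub> homology_class k w = homology_class k (r \<odot>\<^bsub>C k\<^esub> w)"
proof -
  interpret abelian_subgroup "bounds k" "C k" by (rule bounds_subgroup)
  have "homology_class k (r \<odot>\<^bsub>C k\<^esub> x) = homology_class k (r \<odot>\<^bsub>C k\<^esub> w)" if x: "x \<in> homology_class k w" for x
  proof -
    obtain b where b: "b \<in> bounds k" "x = b \<oplus>\<^bsub>C k\<^esub> w"
      using x by (auto simp: homology_class_def a_r_coset_def')
    have "r \<odot>\<^bsub>C k\<^esub> x = r \<odot>\<^bsub>C k\<^esub> b \<oplus>\<^bsub>C k\<^esub> r \<odot>\<^bsub>C k\<^esub> w"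
      using C.M.smult_r_distr[of r b k w] bounds_carrier[OF b(1)] assms b(2) by simp
    then show ?thesis
      using bounds_smult[OF b(1)] bounds_carrier[OF b(1)] assms b(2)
      by (subst homology_class_eq_iff) auto
  qed
  moreover have "w \<in> homology_class k w" unfolding homology_class_def by (rule a_rcos_self[OF assms])
  ultimately have "(\<Union>x\<in>homology_class k w. homology_class k (r \<odot>\<^bsub>C k\<^esub> x)) = homology_class k (r \<odot>\<^bsub>C k\<^esub> w)"
    by blast
  then show ?thesis
    by (simp add: homology_bounds quotient_module_def homology_class_def a_r_coset_def')
qed

lemma homology_class_zero_iff:
  assumes "w \<in> carrier (C k)"
  shows "homology_class k w = bounds k \<longleftrightarrow> w \<in> bounds k"
proof -
  interpret abelian_subgroup "bounds k" "C k" by (rule bounds_subgroup)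
  have "w \<in> homology_class k w" unfolding homology_class_def by (rule a_rcos_self[OF assms])
  moreover have "w \<in> bounds k \<Longrightarrow> homology_class k w = bounds k"
    unfolding homology_class_def by (rule a_rcos_const)
  ultimately show ?thesis by blast
qed

lemma carrier_torsion:
  "carrier (torsion_submodule R p (homology C d k)) = homology_class k ` torsion_chains k"
proof -
  have "(\<exists>n::nat. (p [^]\<^bsub>R\<^esub> n) \<odot>\<^bsub>homology C d k\<^esub> homology_class k w = \<zero>\<^bsub>homology C d k\<^esub>)
      \<longleftrightarrow> w \<in> torsion_chains k" if "w \<in> cycles C d k" for w
  proof -
    have "w \<in> carrier (C k)" using that by (auto simp: cycles_def a_kernel_def' split: if_splits)
    then show ?thesis
      by (simp add: smult_homology zero_homology homology_class_zero_iff torsion_chains_def)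
  qed
  then show ?thesis
    using torsion_chains_cycles by (auto simp: torsion_submodule_def carrier_homology)
qed

context
  fixes k :: nat and J :: "'j set" and n :: "'j \<Rightarrow> nat" and y :: "'j \<Rightarrow> 'm \<Rightarrow> 'a fract"
  assumes stacked: "stacked_basis p D0 k J n y"
begin

lemma
  shows stacked_finite: "finite J"
    and stacked_chains: "j \<in> J \<Longrightarrow> y j \<in> chains p D0 k"
    and stacked_independent: "combination J y r = (\<lambda>x. 0) \<Longrightarrow> j \<in> J \<Longrightarrow> r j = 0"
    and stacked_saturated: "z \<in> chains p D0 k \<Longrightarrow> range r \<subseteq> L \<Longrightarrow> (\<lambda>x. \<pi> * z x) = combination J y r \<Longrightarrow>
       \<exists>r. range r \<subseteq> L \<and> z = combination J y r"
    and stacked_image: "boundary D0 (Suc k) ` chains p D0 (Suc k) =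
      {combination J y (\<lambda>j. r j * \<pi> ^ n j) |r. range r \<subseteq> L}"
  using stacked unfolding stacked_basis_def by blast+

lemma coefficients_unique:
  assumes "\<And>x. combination J y r x = combination J y s x" "j \<in> J"
  shows "r j = s j"
proof -
  have "combination J y (\<lambda>j. r j + - 1 * s j) = (\<lambda>x. 0)"
    by (rule ext) (simp only: combination_add combination_scale assms(1), simp)
  from stacked_independent[OF this assms(2)] show ?thesis by simp
qed

text \<open>
  Some multiple of \<open>w\<close> by a power of \<open>p\<close> lies in the image of the boundary and hence in the span of
  the stacked basis; saturation removes the factors \<open>p\<close> one by one.
\<close>

lemma coefficients_exist:
  assumes "w \<in> torsion_chains k"
  shows "\<exists>r. range r \<subseteq> L \<and> \<kappa> k w = combination J y r"
proof -
  obtain s where w: "w \<in> carrier (C k)" "p ^ s \<odot>\<^bsub>C k\<^esub> w \<in> bounds k"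
    using assms by (auto simp: torsion_chains_def)
  then obtain x where x: "x \<in> carrier (C (Suc k))" "p ^ s \<odot>\<^bsub>C k\<^esub> w = d (Suc k) x"
    by (auto simp: bounds_def)
  have "\<kappa> k (d (Suc k) x) \<in> boundary D0 (Suc k) ` chains p D0 (Suc k)"
    unfolding boundary_chain[OF x(1), symmetric] by (rule imageI) (rule chain_in_chains)
  then obtain r where r: "range r \<subseteq> L" "\<kappa> k (d (Suc k) x) = combination J y (\<lambda>j. r j * \<pi> ^ n j)"
    unfolding stacked_image by auto
  have "(\<lambda>y. \<pi> ^ s * \<kappa> k w y) = combination J y (\<lambda>j. r j * \<pi> ^ n j)"
    unfolding r(2)[symmetric] x(2)[symmetric] by (simp add: C.localized_chain_smult w(1) fun_eq_iff)
  moreover have "range (\<lambda>j. r j * \<pi> ^ n j) \<subseteq> L"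
    using r(1) by (auto intro!: mult_in_L power_in_L)
  ultimately have "\<exists>r. range r \<subseteq> L \<and> (\<lambda>y. \<pi> ^ s * \<kappa> k w y) = combination J y r"
    by (intro exI[of _ "\<lambda>j. r j * \<pi> ^ n j"]) simp
  then show ?thesis
  proof (induction s)
    case 0
    then show ?case by simp
  next
    case (Suc s)
    then obtain r where r: "range r \<subseteq> L" "(\<lambda>y. \<pi> ^ Suc s * \<kappa> k w y) = combination J y r"
      by (elim exE conjE)
    have "(\<lambda>y. \<pi> ^ s * \<kappa> k w y) \<in> chains p D0 k"
      using chain_in_chains[of k w] by (auto simp: chains_def intro!: mult_in_L power_in_L)
    moreover have "(\<lambda>y. \<pi> * (\<pi> ^ s * \<kappa> k w y)) = combination J y r"
      using r(2) by (simp add: mult.assoc)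
    ultimately show ?case using stacked_saturated[OF _ r(1)] Suc.IH by simp
  qed
qed

text \<open>
  On \<open>J\<close> the choice is unique by independence of the stacked basis.
\<close>

definition coefficients :: "'m \<Rightarrow> 'j \<Rightarrow> 'a fract"
  where "coefficients w = (SOME r. range r \<subseteq> L \<and> \<kappa> k w = combination J y r)"

lemma coefficients:
  assumes "w \<in> torsion_chains k"
  shows "coefficients w j \<in> L" "\<kappa> k w = combination J y (coefficients w)"
proof -
  have "range (coefficients w) \<subseteq> L \<and> \<kappa> k w = combination J y (coefficients w)"
    unfolding coefficients_def by (rule someI_ex[OF coefficients_exist[OF assms]])
  then show "coefficients w j \<in> L" "\<kappa> k w = combination J y (coefficients w)" by auto
qed

lemma coefficients_eqI:
  assumes "w \<in> torsion_chains k" "\<And>x. \<kappa> k w x = combination J y r x" "j \<in> J"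
  shows "coefficients w j = r j"
  by (rule coefficients_unique[OF _ assms(3)]) (simp flip: assms(2) coefficients(2)[OF assms(1)])

lemma coefficients_add:
  assumes w: "w \<in> torsion_chains k" "w' \<in> torsion_chains k" and j: "j \<in> J"
  shows "coefficients (w \<oplus>\<^bsub>C k\<^esub> w') j = coefficients w j + coefficients w' j"
proof (rule coefficients_eqI[OF torsion_chains_add[OF w] _ j])
  have "w \<in> carrier (C k)" "w' \<in> carrier (C k)" using w by (auto simp: torsion_chains_def)
  then show "\<kappa> k (w \<oplus>\<^bsub>C k\<^esub> w') x = combination J y (\<lambda>j. coefficients w j + coefficients w' j) x" for x
    by (simp add: C.localized_chain_add combination_add flip: coefficients(2)[OF w(1)] coefficients(2)[OF w(2)])
qed

lemma coefficients_smult: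
  assumes w: "w \<in> torsion_chains k" and j: "j \<in> J"
  shows "coefficients (r \<odot>\<^bsub>C k\<^esub> w) j = to_fract r * coefficients w j"
proof (rule coefficients_eqI[OF torsion_chains_smult[OF w] _ j])
  have "w \<in> carrier (C k)" using w by (auto simp: torsion_chains_def)
  then show "\<kappa> k (r \<odot>\<^bsub>C k\<^esub> w) x = combination J y (\<lambda>j. to_fract r * coefficients w j) x" for x
    by (simp add: C.localized_chain_smult combination_scale flip: coefficients(2)[OF w])
qed

lemma homology_class_eq_iff_coefficients:
  assumes w: "w \<in> torsion_chains k" "w' \<in> torsion_chains k"
  shows "homology_class k w = homology_class k w' \<longleftrightarrow>
    (\<forall>j\<in>J. \<exists>l\<in>L. coefficients w j - coefficients w' j = \<pi> ^ n j * l)" (is "_ \<longleftrightarrow> ?r")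
proof -
  have c: "w \<in> carrier (C k)" "w' \<in> carrier (C k)" using w by (auto simp: torsion_chains_def)
  show ?thesis
  proof
    assume "homology_class k w = homology_class k w'"
    then obtain b where b: "b \<in> bounds k" "w = b \<oplus>\<^bsub>C k\<^esub> w'"
      unfolding homology_class_eq_iff[OF c] by blast
    then obtain x where x: "x \<in> carrier (C (Suc k))" "b = d (Suc k) x"
      by (auto simp: bounds_def)
    have "\<kappa> k b \<in> boundary D0 (Suc k) ` chains p D0 (Suc k)"
      unfolding x(2) boundary_chain[OF x(1), symmetric] by (rule imageI) (rule chain_in_chains)
    then obtain r where r: "range r \<subseteq> L" "\<kappa> k b = combination J y (\<lambda>j. r j * \<pi> ^ n j)"
      unfolding stacked_image by auto
    show ?r
    proof
      fix j assume j: "j \<in> J"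
      have "coefficients w j = coefficients b j + coefficients w' j"
        unfolding b(2) by (rule coefficients_add[OF bounds_torsion[OF b(1)] w(2) j])
      moreover have "coefficients b j = r j * \<pi> ^ n j"
        by (rule coefficients_eqI[OF bounds_torsion[OF b(1)] _ j]) (simp add: r(2))
      ultimately have "coefficients w j - coefficients w' j = \<pi> ^ n j * r j" by simp
      then show "\<exists>l\<in>L. coefficients w j - coefficients w' j = \<pi> ^ n j * l" using r(1) by blast
    qed
  next
    assume ?r
    then have "\<forall>j. \<exists>l. l \<in> L \<and> (j \<in> J \<longrightarrow> coefficients w j - coefficients w' j = \<pi> ^ n j * l)"
      using zero_in_L by blast
    from choice[OF this] obtain l where l: "range l \<subseteq> L"
      "\<And>j. j \<in> J \<Longrightarrow> coefficients w j - coefficients w' j = \<pi> ^ n j * l j" by blast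
    define b where "b = w \<oplus>\<^bsub>C k\<^esub> (- 1) \<odot>\<^bsub>C k\<^esub> w'"
    have b: "b \<in> torsion_chains k"
      unfolding b_def by (rule torsion_chains_add[OF w(1) torsion_chains_smult[OF w(2)]])
    have "combination J y (coefficients b) = combination J y (\<lambda>j. l j * \<pi> ^ n j)"
    proof (rule combination_cong)
      fix j assume j: "j \<in> J"
      have "coefficients b j = coefficients w j - coefficients w' j"
        unfolding b_def coefficients_add[OF w(1) torsion_chains_smult[OF w(2)] j] coefficients_smult[OF w(2) j]
        by simp
      then show "coefficients b j = l j * \<pi> ^ n j" using l(2)[OF j] by simp
    qed
    then have "\<kappa> k b \<in> boundary D0 (Suc k) ` chains p D0 (Suc k)"
      unfolding stacked_image using l(1) coefficients(2)[OF b]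
      by (intro CollectI exI[of _ l]) simp
    from torsion_chain_is_boundary[OF b this] have "b \<in> bounds k" .
    moreover have "w = b \<oplus>\<^bsub>C k\<^esub> w'"
      by (rule chain_eqI[where k = k])
        (simp_all add: b_def c C.localized_chain_add C.localized_chain_smult)
    ultimately show "homology_class k w = homology_class k w'"
      unfolding homology_class_eq_iff[OF c] by blast
  qed
qed

text \<open>
  The combination of the stacked basis with the coefficients \<open>s\<close> lives over the localization only, and so
  does a preimage of its multiple by a power of \<open>p\<close>. Both are multiplied by a common denominator \<open>b\<close>
  and by an inverse of \<open>b\<close> modulo that power, which leaves the residue classes unchanged.
\<close>

lemma coefficients_realized:
  fixes s :: "'j \<Rightarrow> 'a"
  shows "\<exists>w\<in>torsion_chains k. \<forall>j\<in>J. residue (n j) (coefficients w j) = power_coset p (n j) (s j)"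
proof -
  define e where "e = (\<Sum>j\<in>J. n j)"
  \<comment> \<open>Any common upper bound of the exponents would do.\<close>
  have n_le: "n j \<le> e" if "j \<in> J" for j
    unfolding e_def using stacked_finite that by (intro member_le_sum) auto
  define z where "z = combination J y (\<lambda>j. to_fract (s j))"
  have z: "z \<in> chains p D0 k"
    using stacked_chains by (auto simp: chains_def z_def combination_def intro!: sum_in_L mult_in_L sum.neutral)
  have "(\<lambda>x. \<pi> ^ e * z x) = combination J y (\<lambda>j. \<pi> ^ e * to_fract (s j))"
    unfolding z_def by (rule ext) (rule combination_scale[symmetric])
  also have "\<dots> = combination J y (\<lambda>j. (to_fract (s j) * \<pi> ^ (e - n j)) * \<pi> ^ n j)"
    by (rule combination_cong) (simp add: n_le mult.assoc mult.commute flip: power_add)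
  finally have "(\<lambda>x. \<pi> ^ e * z x) = combination J y (\<lambda>j. (to_fract (s j) * \<pi> ^ (e - n j)) * \<pi> ^ n j)" .
  moreover have "range (\<lambda>j. to_fract (s j) * \<pi> ^ (e - n j)) \<subseteq> L" by (auto intro!: mult_in_L power_in_L)
  ultimately have "(\<lambda>x. \<pi> ^ e * z x) \<in> boundary D0 (Suc k) ` chains p D0 (Suc k)"
    unfolding stacked_image by (intro CollectI exI[of _ "\<lambda>j. to_fract (s j) * \<pi> ^ (e - n j)"]) simp
  then obtain c where c: "c \<in> chains p D0 (Suc k)" "boundary D0 (Suc k) c = (\<lambda>x. \<pi> ^ e * z x)" by auto
  obtain b1 w1 where 1: "\<not> p dvd b1" "w1 \<in> carrier (C k)" "\<forall>x. \<kappa> k w1 x = to_fract b1 * z x"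
    using chain_denominator[OF z] by (elim exE conjE)
  obtain b2 w2 where 2: "\<not> p dvd b2" "w2 \<in> carrier (C (Suc k))" "\<forall>x. \<kappa> (Suc k) w2 x = to_fract b2 * c x"
    using chain_denominator[OF c(1)] by (elim exE conjE)
  have e2: "\<kappa> (Suc k) w2 = (\<lambda>x. to_fract b2 * c x)" using 2(3) by (simp add: fun_eq_iff)
  have "\<not> p dvd b2 * b1" using 1(1) 2(1) prime by (simp add: prime_elem_dvd_mult_iff)
  then obtain u v where uv: "u * (b2 * b1) + v * p ^ e = 1" using bezout_prime_power[OF pid] by blast
  define w where "w = (u * b2) \<odot>\<^bsub>C k\<^esub> w1"
  have wc: "w \<in> carrier (C k)" using 1(2) by (simp add: w_def)
  have "p ^ e \<odot>\<^bsub>C k\<^esub> w = (u * b1) \<odot>\<^bsub>C k\<^esub> d (Suc k) w2"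
  proof (rule chain_eqI[where k = k])
    fix x
    have "\<kappa> k (d (Suc k) w2) x = to_fract b2 * (\<pi> ^ e * z x)"
      unfolding boundary_chain[OF 2(2), symmetric] e2 by (simp add: boundary_scale c(2))
    then show "\<kappa> k (p ^ e \<odot>\<^bsub>C k\<^esub> w) x = \<kappa> k ((u * b1) \<odot>\<^bsub>C k\<^esub> d (Suc k) w2) x"
      using 1 2(2) by (simp add: w_def C.localized_chain_smult d_closed)
  qed (use wc 2(2) in \<open>simp_all add: d_closed\<close>)
  also have "\<dots> \<in> bounds k" by (rule bounds_smult) (use 2(2) in \<open>simp add: bounds_def\<close>)
  finally have w: "w \<in> torsion_chains k" using wc by (auto simp: torsion_chains_def)
  have "residue (n j) (coefficients w j) = power_coset p (n j) (s j)" if j: "j \<in> J" for j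
  proof (rule residue_eqI[OF pid coefficients(1)[OF w]])
    have "coefficients w j = to_fract (u * b2 * b1) * to_fract (s j)"
      by (rule coefficients_eqI[OF w _ j, of "\<lambda>j. to_fract (u * b2 * b1) * to_fract (s j)"])
        (use 1 in \<open>simp add: w_def C.localized_chain_smult combination_scale z_def[symmetric]\<close>)
    also have "to_fract (u * b2 * b1) = 1 - to_fract (v * p ^ e)"
    proof -
      have "u * b2 * b1 = 1 - v * p ^ e" using uv by (simp add: algebra_simps)
      then show ?thesis by (simp only: to_fract_diff to_fract_1)
    qed
    also have "\<dots> * to_fract (s j) = to_fract (s j) + \<pi> ^ n j * (\<pi> ^ (e - n j) * - to_fract (v * s j))"
      using n_le[OF j] by (simp add: algebra_simps flip: power_add)
    finally show "coefficients w j = to_fract (s j) + \<pi> ^ n j * (\<pi> ^ (e - n j) * - to_fract (v * s j))" .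
    show "\<pi> ^ (e - n j) * - to_fract (v * s j) \<in> L"
      by (intro mult_in_L power_in_L minus_in_L to_fract_in_L)
  qed
  with w show ?thesis by blast
qed

text \<open>
  The map to the direct sum sends a torsion element to the residue classes of its coefficients. Indices
  with exponent zero may be dropped, as the corresponding quotients vanish.
\<close>

lemma torsion_isomorphic:
  assumes "J' \<subseteq> J" "\<And>j. j \<in> J - J' \<Longrightarrow> n j = 0"
  shows "module_isomorphic R (torsion_submodule R p (homology C d k))
    (finite_direct_sum J' (\<lambda>j. power_quotient p (n j)))"
proof -
  let ?Q = "finite_direct_sum J' (\<lambda>j. power_quotient p (n j))"
  define \<phi> where "\<phi> w = (\<lambda>j\<in>J'. residue (n j) (coefficients w j))" for w
  have tc: "w \<in> carrier (C k)" if "w \<in> torsion_chains k" for w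
    using that by (simp add: torsion_chains_def)
  have J: "j \<in> J" if "j \<in> J'" for j using that assms(1) by blast
  show ?thesis
  proof (rule module_isomorphicI[where q = "homology_class k" and \<phi> = \<phi> and T = "torsion_chains k"
        and plus_T = "\<lambda>x y. x \<oplus>\<^bsub>C k\<^esub> y" and scale_T = "\<lambda>r x. r \<odot>\<^bsub>C k\<^esub> x"])
    show "carrier (torsion_submodule R p (homology C d k)) = homology_class k ` torsion_chains k"
      by (rule carrier_torsion)
    show "carrier ?Q = \<phi> ` torsion_chains k"
    proof
      show "\<phi> ` torsion_chains k \<subseteq> carrier ?Q"
      proof (rule image_subsetI)
        fix w assume w: "w \<in> torsion_chains k"
        show "\<phi> w \<in> carrier ?Q"
          unfolding \<phi>_def finite_direct_sum_def
          by (simp add: residue_quotient(1)[OF pid coefficients(1)[OF w] zero_in_L])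
      qed
      show "carrier ?Q \<subseteq> \<phi> ` torsion_chains k"
      proof
        fix f assume f: "f \<in> carrier ?Q"
        then have "\<forall>j. \<exists>s. j \<in> J' \<longrightarrow> f j = power_coset p (n j) s"
          by (auto simp: finite_direct_sum_def carrier_quotient)
        from choice[OF this] obtain s where s: "\<And>j. j \<in> J' \<Longrightarrow> f j = power_coset p (n j) (s j)" by blast
        obtain w where w: "w \<in> torsion_chains k"
          "\<forall>j\<in>J. residue (n j) (coefficients w j) = power_coset p (n j) (s j)"
          using coefficients_realized by blast
        have "f = \<phi> w"
        proof (rule extensionalityI[of _ J'])
          show "f \<in> extensional J'" using f by (simp add: finite_direct_sum_def PiE_def)
          show "\<phi> w \<in> extensional J'" by (simp add: \<phi>_def)
          show "f j = \<phi> w j" if "j \<in> J'" for j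
            using w(2) s[OF that] J[OF that] that by (simp add: \<phi>_def)
        qed
        then show "f \<in> \<phi> ` torsion_chains k" using w(1) by blast
      qed
    qed
  next
    fix w w' assume w: "w \<in> torsion_chains k" "w' \<in> torsion_chains k"
    have "homology_class k w = homology_class k w' \<longleftrightarrow>
        (\<forall>j\<in>J. residue (n j) (coefficients w j) = residue (n j) (coefficients w' j))"
      unfolding homology_class_eq_iff_coefficients[OF w]
      using residue_eq_iff[OF pid coefficients(1)[OF w(1)] coefficients(1)[OF w(2)]] by simp
    also have "\<dots> \<longleftrightarrow> (\<forall>j\<in>J'. residue (n j) (coefficients w j) = residue (n j) (coefficients w' j))"
    proof -
      have "residue 0 x = residue 0 x'" for x x' by (simp add: residue_def power_coset_def)
      then have "residue (n j) x = residue (n j) x'" if "j \<in> J - J'" for j x x'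
        unfolding assms(2)[OF that] .
      then show ?thesis using J by blast
    qed
    also have "\<dots> \<longleftrightarrow> \<phi> w = \<phi> w'"
    proof
      assume eq: "\<phi> w = \<phi> w'"
      show "\<forall>j\<in>J'. residue (n j) (coefficients w j) = residue (n j) (coefficients w' j)"
      proof
        fix j assume "j \<in> J'"
        then show "residue (n j) (coefficients w j) = residue (n j) (coefficients w' j)"
          using fun_cong[OF eq, of j] by (simp add: \<phi>_def)
      qed
    next
      assume "\<forall>j\<in>J'. residue (n j) (coefficients w j) = residue (n j) (coefficients w' j)"
      then show "\<phi> w = \<phi> w'" unfolding \<phi>_def by (intro restrict_ext) simp
    qed
    finally show "homology_class k w = homology_class k w' \<longleftrightarrow> \<phi> w = \<phi> w'" .
    show "w \<oplus>\<^bsub>C k\<^esub> w' \<in> torsion_chains k" by (rule torsion_chains_add[OF w])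
    show "homology_class k (w \<oplus>\<^bsub>C k\<^esub> w')
        = homology_class k w \<oplus>\<^bsub>torsion_submodule R p (homology C d k)\<^esub> homology_class k w'"
      using add_homology[OF tc[OF w(1)] tc[OF w(2)]] by (simp add: torsion_submodule_def)
    show "\<phi> (w \<oplus>\<^bsub>C k\<^esub> w') = \<phi> w \<oplus>\<^bsub>?Q\<^esub> \<phi> w'"
    proof -
      have "residue (n j) (coefficients (w \<oplus>\<^bsub>C k\<^esub> w') j)
          = residue (n j) (coefficients w j) \<oplus>\<^bsub>power_quotient p (n j)\<^esub> residue (n j) (coefficients w' j)"
        if "j \<in> J'" for j
        unfolding coefficients_add[OF w J[OF that]]
        by (rule residue_quotient(2)[OF pid coefficients(1)[OF w(1)] coefficients(1)[OF w(2)]])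
      then show ?thesis by (auto simp: \<phi>_def finite_direct_sum_def intro!: restrict_ext)
    qed
  next
    fix r w assume w: "w \<in> torsion_chains k"
    show "r \<odot>\<^bsub>C k\<^esub> w \<in> torsion_chains k" by (rule torsion_chains_smult[OF w])
    show "homology_class k (r \<odot>\<^bsub>C k\<^esub> w)
        = r \<odot>\<^bsub>torsion_submodule R p (homology C d k)\<^esub> homology_class k w"
      using smult_homology[OF tc[OF w]] by (simp add: torsion_submodule_def)
    show "\<phi> (r \<odot>\<^bsub>C k\<^esub> w) = r \<odot>\<^bsub>?Q\<^esub> \<phi> w"
    proof -
      have "residue (n j) (coefficients (r \<odot>\<^bsub>C k\<^esub> w) j)
          = r \<odot>\<^bsub>power_quotient p (n j)\<^esub> residue (n j) (coefficients w j)" if "j \<in> J'" for j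
        unfolding coefficients_smult[OF w J[OF that]]
        by (rule residue_quotient(3)[OF pid coefficients(1)[OF w] zero_in_L])
      then show ?thesis by (auto simp: \<phi>_def finite_direct_sum_def intro!: restrict_ext)
    qed
  qed
qed

end

end

theorem lemma4p2:
  fixes p :: "'a::idom"
    and N :: nat
    and C :: "nat \<Rightarrow> ('a, 'm) module"
    and d :: "nat \<Rightarrow> 'm \<Rightarrow> 'm"
    and I :: "nat \<Rightarrow> 'm set"
    and D E :: "nat \<Rightarrow> ('m, 'a fract) based_complex"
    and m :: "nat \<Rightarrow> nat \<Rightarrow> nat"
    and a :: "nat \<Rightarrow> nat"
  assumes "principal_domain (ring_of_type_algebra :: 'a ring)"
    and "prime_elem p"
    and "chain_complex (ring_of_type_algebra :: 'a ring) N C d"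
    and "\<And>k. finite_basis (ring_of_type_algebra :: 'a ring) (C k) (I k)"
    and "procedure_run p (localized_complex C I d) D E m a"
  shows "\<exists>t. stops_at E t \<and> zero_boundaries (D t) \<and>
    (\<forall>k. module_isomorphic (ring_of_type_algebra :: 'a ring)
       (torsion_submodule (ring_of_type_algebra :: 'a ring) p (homology C d k))
       (finite_direct_sum {(i, j). 1 \<le> i \<and> i < t \<and> j < m (k + 1) i}
          (\<lambda>(i, j). quotient_module (regular_module (ring_of_type_algebra :: 'a ring))
             (PIdl\<^bsub>(ring_of_type_algebra :: 'a ring)\<^esub> (p ^ (\<Sum>l = 1..i. a l))))))"
proof -
  interpret based_chain_complex p N C d I
    by (intro based_chain_complex.intro localization_at_prime.intro based_chain_complex_axioms.intro)
      (fact assms)+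
  interpret procedure p D0 D E m a
    by (intro procedure.intro procedure_axioms.intro localization_at_prime_axioms
        assms(5) localized_local_complex)
  obtain t where t: "zero_boundaries (E t)" "\<forall>j<t. \<not> zero_boundaries (E j)"
    using procedure_stops by blast
  have "module_isomorphic R (torsion_submodule R p (homology C d k))
      (finite_direct_sum {(i, j). 1 \<le> i \<and> i < Suc t \<and> j < m (k + 1) i}
        (\<lambda>(i, j). quotient_module (regular_module R) (PIdl\<^bsub>R\<^esub> (p ^ (\<Sum>l = 1..i. a l)))))" for k
  proof -
    let ?n = "\<lambda>(i, j). \<Sum>l = Suc 0..i. a l"
    obtain y where y: "stacked_basis p (D 0) k {(i, j). 0 \<le> i \<and> i \<le> t \<and> j < m (Suc k) i} ?n y"
      using stacked_basis_run[OF t, of 0 k] by auto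
    have "D 0 = D0" using run by (simp add: procedure_run_def)
    note iso = torsion_isomorphic[OF y[unfolded this],
        of "{(i, j). 1 \<le> i \<and> i < Suc t \<and> j < m (k + 1) i}"]
    have eq: "(\<lambda>(i, j). quotient_module (regular_module R) (PIdl\<^bsub>R\<^esub> (p ^ (\<Sum>l = 1..i. a l))))
        = (\<lambda>j. power_quotient p (?n j))"
      by (auto simp: fun_eq_iff power_quotient_def One_nat_def)
    show ?thesis
    proof (subst eq, rule iso)
      show "{(i, j). 1 \<le> i \<and> i < Suc t \<and> j < m (k + 1) i} \<subseteq> {(i, j). 0 \<le> i \<and> i \<le> t \<and> j < m (Suc k) i}"
        by (auto simp: One_nat_def)
      fix x
      assume "x \<in> {(i, j). 0 \<le> i \<and> i \<le> t \<and> j < m (Suc k) i}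
          - {(i, j). 1 \<le> i \<and> i < Suc t \<and> j < m (k + 1) i}"
      \<comment> \<open>The dropped indices have \<open>i = 0\<close>, where the exponent is an empty sum.\<close>
      then have "fst x = 0" by (cases "fst x") (auto simp: One_nat_def)
      then show "?n x = 0" by (simp add: case_prod_beta)
    qed
  qed
  moreover have "stops_at E (Suc t)" using t by (auto simp: stops_at_def)
  moreover have "zero_boundaries (D (Suc t))" using run_step(3)[OF t(2) t(1)] t(1) by simp
  ultimately show ?thesis by blast
qed

end
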